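(* Let $r_M>0$ and let $r:(0,\infty)\times[0,r_M]\to\mathbb{R}$ satisfy $0\le r(x,I)\le r_M$ for all $x>0$, $I\in[0,r_M]$, $\frac{\partial r}{\partial I}\in L^\infty((0,\infty)\times(0,r_M))$, and $r(x,I)\ge r_0$ for some constant $r_0>0$. Let $n_{\rm ini}\in L^1(0,\infty)$, $n_{\rm ini}\ge0$, $\int_0^\infty n_{\rm ini}=1$, and $I_{\rm ini}\in[0,r_M]$. For $d>0$ let $n_d(t,x)$ be the solution, and $I_d(t)=n_d(t,0)$ the associated activity function, of $$\begin{cases}\partial_t n(t,x)+\partial_x n(t,x)+r(x,I(t-d))\,n(t,x)=0, & t,x\ge0,\\ I(t)=\int_0^\infty r(x,I(t-d))\,n(t,x)\,dx, & t\geq 0,\\ n(t,x=0)=I(t),\\ n(t=0)=n_{\rm ini},\\ I(t)=I_{\rm ini}, & t\in[-d,0),\end{cases}$$ and set $\widetilde n_d(\tau)=n_d(\tau d)$, $\widetilde I_d(\tau)=I_d(\tau d)$. Set $\Phi^0(I)\equiv I$ and define $$\widetilde n_\infty(\tau,x,I_{\rm ini})=\sum_{k=1}^\infty\overline n(x,\Phi^{k-1}(I_{\rm ini}))\mathbf 1_{k-1\le\tau<k},\qquad\widetilde I_\infty(\tau,I_{\rm ini})=\sum_{k=0}^\infty\Phi^k(I_{\rm ini})\mathbf 1_{k-1\le\tau<k}.$$ Then for every $N\in\mathbb N$, $$\lim_{d\to\infty}\int_0^N\big\|\widetilde n_d(\tau)-\widetilde n_\infty(\tau,\cdot,I_{\rm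 ini})\big\|_1d\tau=0\quad\text{and}\quad\lim_{d\to\infty}\int_0^N\big|\widetilde I_d(\tau)-\widetilde I_\infty(\tau,I_{\rm ini})\big|d\tau=0.$$
   Context: Notation: $\|u\|_1=\int_0^\infty|u(x)|\,dx$; $R(x,I)=\int_0^xr(y,I)\,dy$; $\Phi(I)=\big(\int_0^\infty e^{-R(x,I)}dx\big)^{-1}$, which maps $[0,r_M]$ to $[0,r_M]$; $\Phi^k$ is the $k$-th iterate of $\Phi$; $\overline n(x,I)=\Phi(I)e^{-R(x,I)}$. A solution of the delayed equation is $n\in C([0,\infty);L^1(0,\infty))$ with $n\ge0$, $\int_0^\infty n(t,x)dx=1$, together with a measurable activity $I:[-d,\infty)\to[0,r_M]$; the transport equation is understood in the weak sense (by characteristics): $n(t,x)=n_{\rm ini}(x-t)\exp(-\int_0^t r(x-t+s,I(s-d))ds)$ for $x\ge t$ and $n(t,x)=I(t-x)\exp(-\int_0^x r(s,I(t-x+s-d))ds)$ for $x<t$. *)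

theory Defs
  imports "HOL-Analysis.Analysis"
begin

definition L1_norm :: "(real \<Rightarrow> real) \<Rightarrow> real" where
  "L1_norm u = (LINT x:{0<..}|lebesgue. \<bar>u x\<bar>)"

definition Linfty :: "'a::euclidean_space set \<Rightarrow> ('a \<Rightarrow> real) \<Rightarrow> bool" where
  "Linfty \<Omega> g \<longleftrightarrow> g \<in> borel_measurable (lebesgue_on \<Omega>) \<and>
     (\<exists>C. AE z in lebesgue_on \<Omega>. \<bar>g z\<bar> \<le> C)"

(* Test functions are taken in C^1_c (as, for instance, in Brezis' treatment of Sobolev spaces); for
   locally integrable functions this gives the same weak derivatives as C^infinity_c. *)
definition C1_compact_support :: "(real \<times> real) set \<Rightarrow> (real \<times> real \<Rightarrow> real) \<Rightarrow> bool" where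
  "C1_compact_support \<Omega> \<phi> \<longleftrightarrow>
     (\<exists>D. (\<forall>z. (\<phi> has_derivative blinfun_apply (D z)) (at z)) \<and> continuous_on UNIV D) \<and>
     compact (closure {z. \<phi> z \<noteq> 0}) \<and> closure {z. \<phi> z \<noteq> 0} \<subseteq> \<Omega>"

definition weak_partial_snd ::
    "(real \<times> real) set \<Rightarrow> (real \<Rightarrow> real \<Rightarrow> real) \<Rightarrow> (real \<times> real \<Rightarrow> real) \<Rightarrow> bool" where
  "weak_partial_snd \<Omega> r g \<longleftrightarrow> (\<forall>\<phi>. C1_compact_support \<Omega> \<phi> \<longrightarrow>
     (LINT z:\<Omega>|lebesgue. r (fst z) (snd z) * deriv (\<lambda>J. \<phi> (fst z, J)) (snd z)) =
     - (LINT z:\<Omega>|lebesgue. g z * \<phi> z))"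

definition R_int :: "(real \<Rightarrow> real \<Rightarrow> real) \<Rightarrow> real \<Rightarrow> real \<Rightarrow> real" where
  "R_int r x I = (LINT y:{0<..x}|lebesgue. r y I)"

definition Phi :: "(real \<Rightarrow> real \<Rightarrow> real) \<Rightarrow> real \<Rightarrow> real" where
  "Phi r I = inverse (LINT x:{0<..}|lebesgue. exp (- R_int r x I))"

definition nbar :: "(real \<Rightarrow> real \<Rightarrow> real) \<Rightarrow> real \<Rightarrow> real \<Rightarrow> real" where
  "nbar r x I = Phi r I * exp (- R_int r x I)"

(* n t x is the density at time t and age x.  The transport equation with its boundary and initial
   conditions is the representation along characteristics, an identity between elements of L^1,
   hence for almost every x.  The condition n t 0 = I t only fixes the value at the null set x = 0. *)
definition delayed_solution ::
    "(real \<Rightarrow> real \<Rightarrow> real) \<Rightarrow> real \<Rightarrow> (real \<Rightarrow> real) \<Rightarrow> real \<Rightarrow> real \<Rightarrow>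
     (real \<Rightarrow> real \<Rightarrow> real) \<Rightarrow> (real \<Rightarrow> real) \<Rightarrow> bool" where
  "delayed_solution r rM n_ini I_ini d n I \<longleftrightarrow>
     I \<in> borel_measurable (lebesgue_on {-d..}) \<and>
     (\<forall>t\<ge>-d. I t \<in> {0..rM}) \<and>
     (\<forall>t\<ge>0. set_integrable lebesgue {0<..} (n t)) \<and>
     (\<forall>t\<ge>0. ((\<lambda>s. L1_norm (\<lambda>x. n s x - n t x)) \<longlongrightarrow> 0) (at t within {0..})) \<and>
     (\<forall>t\<ge>0. AE x in lebesgue_on {0<..}. n t x \<ge> 0) \<and>
     (\<forall>t\<ge>0. (LINT x:{0<..}|lebesgue. n t x) = 1) \<and>
     (\<forall>t\<ge>0. AE x in lebesgue_on {0<..}. n t x =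
        (if x \<ge> t
         then n_ini (x - t) * exp (- (LINT s:{0..t}|lebesgue. r (x - t + s) (I (s - d))))
         else I (t - x) * exp (- (LINT s:{0..x}|lebesgue. r s (I (t - x + s - d)))))) \<and>
     (\<forall>t\<ge>0. I t = (LINT x:{0<..}|lebesgue. r x (I (t - d)) * n t x)) \<and>
     (\<forall>t\<ge>0. n t 0 = I t) \<and>
     (\<forall>t\<in>{-d..<0}. I t = I_ini)"

(* The series below have at most one nonzero term for each tau. *)
definition n_infty :: "(real \<Rightarrow> real \<Rightarrow> real) \<Rightarrow> real \<Rightarrow> real \<Rightarrow> real \<Rightarrow> real" where
  "n_infty r \<tau> x I_ini =
     (\<Sum>\<^sub>\<infinity>k\<in>{1..}. nbar r x ((Phi r ^^ (k - 1)) I_ini) * indicator {real k - 1..<real k} \<tau>)"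

definition I_infty :: "(real \<Rightarrow> real \<Rightarrow> real) \<Rightarrow> real \<Rightarrow> real \<Rightarrow> real" where
  "I_infty r \<tau> I_ini =
     (\<Sum>\<^sub>\<infinity>k. (Phi r ^^ k) I_ini * indicator {real k - 1..<real k} \<tau>)"

end

theory Submission
  imports Defs
begin

text \<open>
On the slow time scale each delay period has length 1, and during the period \<open>[k, k + 1)\<close> the
equation is the age-structured equation without delay whose rate is driven by the activity of the
previous period. If that activity is nearly the constant \<open>J\<close>, the equation is nearly linear and
autonomous, and its solution relaxes to the stationary density \<open>nbar r x J\<close>, whose activity is
\<open>Phi r J\<close>. The relaxation takes a time that does not grow with \<open>d\<close>, hence a vanishing part of the
period as \<open>d \<longlongrightarrow> \<infinity>\<close>. Starting from the constant initial history, one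
obtains the iterates of \<open>Phi r\<close>.

The relaxation is proved without differential inequalities. Let \<open>J' = Phi r J\<close>. At an age that is
small compared with the time spent in the period, the density is \<open>I(t - x)\<close> times a survival
function which is close to \<open>exp (- R_int r x J)\<close>. Since the mass is conserved, the error
\<open>I(t) - J'\<close> equals, up to vanishing terms, the integral of the past errors \<open>I(t - x) - J'\<close> against
the weight \<open>(r x J - r0) * exp (- R_int r x J)\<close>. This weight is nonnegative, and its integral is
\<open>1 - r0 / J' < 1\<close>. So an eventual bound on the error improves by this factor
(\<open>activity_contraction\<close>); repeating the step makes the error arbitrarily small
(\<open>window_error_bound\<close>), and induction over the periods gives the pointwise limit of the activity
and the \<open>L\<^sup>1\<close> limit of the density (\<open>rescaled_tendsto\<close>). Both are bounded, so dominated
convergence in the rescaled time concludes.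

All limits in the age are taken by dominated convergence along sequences of delays and times, with
dominating function a multiple of \<open>exp (- r0 * x)\<close>. Continuity of the rate in the activity turns
pointwise convergence of the activities into pointwise convergence of the integrands;
\<open>caratheodory_version\<close> first replaces the rate by one that is jointly Borel, so that the
integrands are measurable.
\<close>

section \<open>Lebesgue measure and integrals on the half-line\<close>

lemma AE_lebesgue_affine:
  fixes c t :: real
  assumes "AE x in lebesgue. P x" "c \<noteq> 0"
  shows "AE x in lebesgue. P (t + c * x)"
proof -
  have "AE x in lborel. P x" using assms(1) by (simp add: AE_completion_iff)
  then obtain N where N: "{x \<in> space lborel. \<not> P x} \<subseteq> N" "emeasure lborel N = 0" "N \<in> sets lborel"
    by (rule AE_E)
  have NP: "P x" if "x \<notin> N" for x using N(1) that by auto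
  have [measurable]: "N \<in> sets borel" using N(3) by simp
  have "AE x in lborel. x \<notin> N" using N by (intro AE_not_in) auto
  then have "AE x in lborel. t + c * x \<notin> N"
    by (intro AE_borel_affine assms) auto
  then have "AE x in lborel. P (t + c * x)" by eventually_elim (rule NP)
  then show ?thesis by (simp add: AE_completion_iff)
qed

lemma borel_measurable_lebesgue_affine:
  fixes c t :: real and f :: "real \<Rightarrow> real"
  assumes "f \<in> borel_measurable lebesgue" "c \<noteq> 0"
  shows "(\<lambda>x. f (t + c * x)) \<in> borel_measurable lebesgue"
proof -
  have "(\<lambda>x. t + (\<Sum>j\<in>Basis. (c * (x \<bullet> j)) *\<^sub>R j)) \<in> lebesgue \<rightarrow>\<^sub>M (lebesgue :: real measure)"
    using assms(2) by (intro lebesgue_affine_measurable) simp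
  then have "(\<lambda>x. t + c * x) \<in> lebesgue \<rightarrow>\<^sub>M (lebesgue :: real measure)" by simp
  from measurable_compose[OF this assms(1)] show ?thesis by simp
qed

lemma borel_imp_lebesgue_measurable [measurable_dest]:
  "f \<in> borel_measurable borel \<Longrightarrow> f \<in> borel_measurable lebesgue"
  by (simp add: measurable_completion)

lemma ident_lebesgue_measurable [measurable]: "(\<lambda>x::real. x) \<in> borel_measurable lebesgue"
  by (simp add: measurable_completion)

lemma integrable_indicator_Icc [simp]: "integrable lebesgue (indicator {a..b::real} :: real \<Rightarrow> real)"
  by (simp add: integrable_real_indicator emeasure_lborel_Icc_eq)

lemma exp_neg_integrable:
  fixes c :: real
  assumes "c > 0"
  shows "set_integrable lebesgue {0<..} (\<lambda>x. exp (- c * x))"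
proof -
  have "set_integrable lebesgue {0..} (\<lambda>x. exp (- c * x))"
    using assms by (intro nonnegative_absolutely_integrable_1 integrable_on_exp_minus_to_infinity) auto
  then show ?thesis by (rule set_integrable_subset) auto
qed

lemma AE_neq_lebesgue: "AE u in lebesgue. u \<noteq> (c::real)"
  by (simp add: AE_completion_iff AE_lborel_singleton)

lemma L1_norm_nonneg: "0 \<le> L1_norm u"
  unfolding L1_norm_def set_lebesgue_integral_def by (rule integral_nonneg_AE) simp

text \<open>
Almost everywhere equality transports measurability because the measure is complete, and a
function that is not integrable has integral 0 by convention. This suits rates of which only the
values along a path are under control.
\<close>

lemma lebesgue_integral_cong_AE_nonmeasurable:
  fixes f g :: "'a::euclidean_space \<Rightarrow> real"
  assumes ae: "AE x in lebesgue. f x = g x"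
  shows "integral\<^sup>L lebesgue f = integral\<^sup>L lebesgue g"
proof -
  have ae': "AE x in lebesgue. g x = f x" using ae by eventually_elim simp
  have iff: "f \<in> borel_measurable lebesgue \<longleftrightarrow> g \<in> borel_measurable lebesgue"
    using borel_measurable_AE[OF _ ae] borel_measurable_AE[OF _ ae'] by blast
  show ?thesis
  proof (cases "f \<in> borel_measurable lebesgue")
    case True
    with iff ae show ?thesis by (intro integral_cong_AE) auto
  next
    case False
    with iff have "\<not> integrable lebesgue f" "\<not> integrable lebesgue g" by auto
    then show ?thesis by (simp add: not_integrable_integral_eq)
  qed
qed

lemma set_lebesgue_integral_cong_AE_nonmeasurable:
  fixes f g :: "'a::euclidean_space \<Rightarrow> real"
  assumes "AE x in lebesgue. x \<in> A \<longrightarrow> f x = g x"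
  shows "(LINT x:A|lebesgue. f x) = (LINT x:A|lebesgue. g x)"
  unfolding set_lebesgue_integral_def
  by (rule lebesgue_integral_cong_AE_nonmeasurable) (use assms in \<open>auto simp: indicator_def elim: eventually_mono\<close>)

text \<open>
A function that is not integrable on the set has integral 0 by convention, so it may be replaced
by 0 before dominated convergence is applied. This saves a proof that the distances between
solution and limit depend measurably on rescaled time.
\<close>

lemma bounded_integral_tendsto_zero:
  fixes f :: "nat \<Rightarrow> 'a \<Rightarrow> real"
  assumes bound: "\<And>j x. x \<in> A \<Longrightarrow> \<bar>f j x\<bar> \<le> C"
    and A: "A \<in> sets M" "emeasure M A < \<infinity>"
    and lim: "AE x in M. x \<in> A \<longrightarrow> (\<lambda>j. f j x) \<longlonglongrightarrow> 0"
  shows "(\<lambda>j. LINT x:A|M. f j x) \<longlonglongrightarrow> 0"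
proof -
  define g where "g j x = (if set_integrable M A (f j) then indicator A x * f j x else 0)" for j x
  have eq: "(LINT x:A|M. f j x) = (LINT x|M. g j x)" for j
    by (cases "set_integrable M A (f j)")
      (simp_all add: g_def set_lebesgue_integral_def set_integrable_def not_integrable_integral_eq)
  have [measurable]: "g j \<in> borel_measurable M" for j
  proof (cases "set_integrable M A (f j)")
    case True
    then have "integrable M (g j)"
      by (simp add: g_def[abs_def] set_integrable_def)
    then show ?thesis by simp
  qed (simp add: g_def[abs_def])
  have "(\<lambda>j. LINT x|M. g j x) \<longlonglongrightarrow> (LINT x|M. 0)"
  proof (rule integral_dominated_convergence[where w = "\<lambda>x. C * indicator A x"])
    show "integrable M (\<lambda>x. C * indicator A x)" using A by (simp add: integrable_real_indicator)
    show "AE x in M. (\<lambda>j. g j x) \<longlonglongrightarrow> 0"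
      using lim
    proof eventually_elim
      case (elim x)
      show ?case
      proof (cases "x \<in> A")
        case True
        with elim have "(\<lambda>j. \<bar>f j x\<bar>) \<longlonglongrightarrow> 0" by (simp add: tendsto_rabs_zero)
        then show ?thesis
          by (rule Lim_null_comparison[rotated]) (auto simp: g_def True)
      qed (simp add: g_def cong: if_cong)
    qed
    show "AE x in M. norm (g j x) \<le> C * indicator A x" for j
    proof (intro AE_I2)
      fix x
      show "norm (g j x) \<le> C * indicator A x"
      proof (cases "x \<in> A")
        case True
        then have "\<bar>f j x\<bar> \<le> C" by (rule bound)
        moreover from this have "0 \<le> C" using abs_ge_zero order_trans by blast
        ultimately show ?thesis by (auto simp: g_def True)
      qed (simp add: g_def)
    qed
  qed auto
  then show ?thesis by (simp add: eq)
qed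

section \<open>Regularised discharge rates and their survival functions\<close>

text \<open>
A discharge rate that is defined on the whole plane, jointly Borel and continuous in the activity
at \<^emph>\<open>every\<close> age. Composing such a rate with a Lebesgue measurable activity gives a Lebesgue
measurable function, which fails for rates that are only Lebesgue measurable in the pair.
\<close>

locale age_rate =
  fixes r :: "real \<Rightarrow> real \<Rightarrow> real" and r0 rM :: real
  assumes r0_pos: "0 < r0"
    and r_borel: "(\<lambda>z. r (fst z) (snd z)) \<in> borel_measurable borel"
    and r_ge: "r0 \<le> r x J" and r_le: "r x J \<le> rM"
    and r_cont: "isCont (r x) J"
begin

lemma r0_le_rM: "r0 \<le> rM" using r_ge[of 0 0] r_le[of 0 0] by simp

lemma rM_pos: "0 < rM" using r0_le_rM r0_pos by simp

lemma r_nonneg: "0 \<le> r x J" using r_ge[of x J] r0_pos by simp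

lemma r_measurable [measurable (raw)]:
  assumes "f \<in> borel_measurable M" "g \<in> borel_measurable M"
  shows "(\<lambda>x. r (f x) (g x)) \<in> borel_measurable M"
proof -
  have "(\<lambda>x. (f x, g x)) \<in> M \<rightarrow>\<^sub>M borel" using assms by (simp add: borel_measurable_Pair)
  from measurable_compose[OF this r_borel] show ?thesis by simp
qed

text \<open>
The hazard accumulated up to age \<open>x\<close> when the individual sees the activity \<open>h u\<close> at age \<open>u\<close>. The
age interval is closed, unlike in \<^const>\<open>R_int\<close>, because the characteristics are given that
way.
\<close>

definition hazard :: "(real \<Rightarrow> real) \<Rightarrow> real \<Rightarrow> real" where
  "hazard h x = (LINT u:{0..x}|lebesgue. r u (h u))"

lemma rate_integrable:
  assumes [measurable]: "h \<in> borel_measurable lebesgue"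
  shows "set_integrable lebesgue {a..b} (\<lambda>u. r u (h u))"
proof -
  have "set_integrable lebesgue {a..b} (\<lambda>u. rM)"
    by (simp add: set_integrable_def)
  then show ?thesis
    by (rule set_integrable_bound) (use r_nonneg r_le rM_pos in \<open>auto simp: set_borel_measurable_def\<close>)
qed

lemma rate_integral_bounds:
  assumes "h \<in> borel_measurable lebesgue" "a \<le> b"
  shows "r0 * (b - a) \<le> (LINT u:{a..b}|lebesgue. r u (h u))"
    and "(LINT u:{a..b}|lebesgue. r u (h u)) \<le> rM * (b - a)"
proof -
  have c: "(LINT u:{a..b}|lebesgue. c) = c * (b - a)" "set_integrable lebesgue {a..b} (\<lambda>u. c)" for c :: real
    using assms by (simp_all add: set_lebesgue_integral_def set_integrable_def)
  show "r0 * (b - a) \<le> (LINT u:{a..b}|lebesgue. r u (h u))"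
    using set_integral_mono[OF c(2) rate_integrable[OF assms(1)]] r_ge by (simp add: c)
  show "(LINT u:{a..b}|lebesgue. r u (h u)) \<le> rM * (b - a)"
    using set_integral_mono[OF rate_integrable[OF assms(1)] c(2)] r_le by (simp add: c)
qed

lemma hazard_ge: "h \<in> borel_measurable lebesgue \<Longrightarrow> 0 \<le> x \<Longrightarrow> r0 * x \<le> hazard h x"
  using rate_integral_bounds[of h 0 x] by (simp add: hazard_def)

lemma hazard_le: "h \<in> borel_measurable lebesgue \<Longrightarrow> 0 \<le> x \<Longrightarrow> hazard h x \<le> rM * x"
  using rate_integral_bounds[of h 0 x] by (simp add: hazard_def)

lemma R_int_eq_hazard: "R_int r x J = hazard (\<lambda>_. J) x"
  unfolding R_int_def hazard_def
  by (rule set_integral_discrete_difference[where X = "{0}"]) auto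

lemma hazard_tendsto:
  assumes [measurable]: "\<And>j. h j \<in> borel_measurable lebesgue"
    and lim: "\<And>u. 0 < u \<Longrightarrow> u \<le> x \<Longrightarrow> (\<lambda>j. h j u) \<longlonglongrightarrow> J"
  shows "(\<lambda>j. hazard (h j) x) \<longlonglongrightarrow> R_int r x J"
  unfolding R_int_eq_hazard hazard_def set_lebesgue_integral_def
proof (rule integral_dominated_convergence[where w = "\<lambda>u. rM * indicator {0..x} u"])
  have "AE u in lebesgue. u \<noteq> (0::real)" by (simp add: AE_completion_iff AE_lborel_singleton)
  then show "AE u in lebesgue. (\<lambda>j. indicator {0..x} u *\<^sub>R r u (h j u)) \<longlonglongrightarrow> indicator {0..x} u *\<^sub>R r u J"
  proof eventually_elim
    case (elim u)
    show ?case
    proof (cases "u \<in> {0..x}")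
      case True
      then have "(\<lambda>j. h j u) \<longlonglongrightarrow> J" using elim by (intro lim) auto
      then show ?thesis by (intro tendsto_intros isCont_tendsto_compose[OF r_cont])
    qed simp
  qed
  show "AE u in lebesgue. norm (indicator {0..x} u *\<^sub>R r u (h j u)) \<le> rM * indicator {0..x} u" for j
    using r_nonneg r_le by (simp add: indicator_def)
qed auto

text \<open>
Joint measurability in \<open>x\<close> and \<open>u\<close> is available for Borel \<open>f\<close> only. Replacing \<open>f\<close> by a Borel
function that agrees with it almost everywhere does not change the hazard at any \<open>x\<close>, since the
exceptional set of \<open>u\<close> is a reflected translate of a null set.
\<close>

lemma hazard_measurable:
  assumes f: "f \<in> borel_measurable lebesgue"
  shows "(\<lambda>x. hazard (\<lambda>u. f (x - u)) x) \<in> borel_measurable lebesgue"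
proof -
  obtain g where [measurable]: "g \<in> borel_measurable borel" and g: "AE x in lborel. f x = g x"
    using completion_ex_borel_measurable_real[OF f] by auto
  have "hazard (\<lambda>u. f (x - u)) x = (LINT u|lborel. indicator {0..x} u * r u (g (x - u)))" for x
  proof -
    have "AE u in lebesgue. f u = g u" using g by (simp add: AE_completion_iff)
    from AE_lebesgue_affine[OF this, of "-1" x]
    have ae: "AE u in lebesgue. f (x - u) = g (x - u)" by simp
    have [measurable]: "(\<lambda>u. f (x - u)) \<in> borel_measurable lebesgue"
      using borel_measurable_lebesgue_affine[OF f, of "-1" x] by simp
    have "hazard (\<lambda>u. f (x - u)) x = (LINT u|lebesgue. indicator {0..x} u * r u (g (x - u)))"
      unfolding hazard_def set_lebesgue_integral_def
      by (rule integral_cong_AE) (use ae in auto)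
    then show ?thesis by (simp add: integral_completion)
  qed
  moreover have "(\<lambda>x. LINT u|lborel. indicator {0..x} u * r u (g (x - u))) \<in> borel_measurable borel"
  proof -
    have "(\<lambda>z::real \<times> real. indicator {z. 0 \<le> snd z \<and> snd z \<le> fst z} z * r (snd z) (g (fst z - snd z)))
        \<in> borel_measurable (borel \<Otimes>\<^sub>M lborel)" by measurable
    then have "(\<lambda>(x, u). indicator {0..x} u * r u (g (x - u))) \<in> borel_measurable (borel \<Otimes>\<^sub>M lborel)"
      by (rule measurable_cong[THEN iffD1, rotated]) (auto simp: indicator_def)
    then show ?thesis by (rule lborel.borel_measurable_lebesgue_integral)
  qed
  ultimately show ?thesis by (simp add: borel_imp_lebesgue_measurable)
qed

text \<open>
Every survival function decays like \<open>exp (- r0 * x)\<close>; this is the dominating function in all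
limits over the age.
\<close>

lemma survival_integrable:
  assumes [measurable]: "K \<in> borel_measurable lebesgue"
    and "\<And>x. 0 < x \<Longrightarrow> \<bar>K x\<bar> \<le> C * exp (- r0 * x)"
  shows "set_integrable lebesgue {0<..} K"
proof -
  have "set_integrable lebesgue {0<..} (\<lambda>x. C * exp (- r0 * x))"
    using exp_neg_integrable[OF r0_pos] by simp
  then show ?thesis
    by (rule set_integrable_bound) (use assms(2) in \<open>force simp: set_borel_measurable_def\<close>)+
qed

lemma R_int_measurable [measurable]: "(\<lambda>x. R_int r x J) \<in> borel_measurable lebesgue"
  using hazard_measurable[of "\<lambda>_. J"] by (simp add: R_int_eq_hazard)

lemma R_int_ge: "0 \<le> x \<Longrightarrow> r0 * x \<le> R_int r x J"
  and R_int_le: "0 \<le> x \<Longrightarrow> R_int r x J \<le> rM * x"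
  by (simp_all add: R_int_eq_hazard hazard_ge hazard_le)

lemma exp_R_int_integrable: "set_integrable lebesgue {0<..} (\<lambda>x. exp (- R_int r x J))"
  by (rule survival_integrable[where C = 1]) (use R_int_ge[of _ J] in auto)

lemma R_int_diff:
  assumes "0 \<le> x" "x \<le> y"
  shows "R_int r y J - R_int r x J = (LINT u:{x..y}|lebesgue. r u J)"
proof -
  have "(LINT u:{x..y}|lebesgue. r u J) = (LINT u:{x<..y}|lebesgue. r u J)"
    by (rule set_integral_discrete_difference[where X = "{x}"]) auto
  moreover have "(LINT u:{0..x} \<union> {x<..y}|lebesgue. r u J)
      = (LINT u:{0..x}|lebesgue. r u J) + (LINT u:{x<..y}|lebesgue. r u J)"
  proof (rule set_integral_Un)
    show "set_integrable lebesgue {0..x} (\<lambda>u. r u J)" by (rule rate_integrable) simp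
    show "set_integrable lebesgue {x<..y} (\<lambda>u. r u J)"
      by (rule set_integrable_subset[OF rate_integrable[of _ x y]]) auto
  qed auto
  moreover have "{0..x} \<union> {x<..y} = {0..y}" using assms by auto
  ultimately show ?thesis by (simp add: R_int_eq_hazard hazard_def)
qed

end

context age_rate begin

text \<open>
The integrand is the derivative of \<open>- exp (- R)\<close> only almost everywhere, as the rate is merely
measurable in age. Instead of differentiating \<open>R\<close>, one compares increments: over \<open>[x, y]\<close> both the
integral and \<open>exp (- R x) - exp (- R y)\<close> lie between \<open>exp (- R y) * \<Delta>\<close> and
\<open>exp (- R x) * \<Delta>\<close> with \<open>\<Delta> = R y - R x \<le> rM * (y - x)\<close>. Their difference \<open>D\<close> thus
has quadratically small increments, hence derivative 0 at every point, and is constant.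
\<close>

lemma survival_flux_antiderivative:
  assumes "0 \<le> x"
  shows "(LINT u:{0..x}|lebesgue. r u J * exp (- R_int r u J)) = 1 - exp (- R_int r x J)"
proof -
  define R where "R x = R_int r x J" for x
  define F where "F x = (LINT u:{0..x}|lebesgue. r u J * exp (- R u))" for x
  define D where "D x = F x + exp (- R x)" for x
  have R0: "R 0 = 0" using R_int_ge[of 0 J] R_int_le[of 0 J] by (simp add: R_def)
  have [measurable]: "R \<in> borel_measurable lebesgue" by (simp add: R_def[abs_def] R_int_measurable)
  have R_nonneg: "0 \<le> R x" if "0 \<le> x" for x
    using R_int_ge[OF that, of J] r0_pos that by (simp add: R_def order_trans[rotated])
  have R_diff: "R y - R x = (LINT u:{x..y}|lebesgue. r u J)" if "0 \<le> x" "x \<le> y" for x y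
    using R_int_diff[OF that] by (simp add: R_def)
  have R_mono: "R x \<le> R y" if "0 \<le> x" "x \<le> y" for x y
  proof -
    have "0 \<le> r0 * (y - x)" using r0_pos that by simp
    then show ?thesis
      using R_diff[OF that] rate_integral_bounds(1)[of "\<lambda>_. J" x y] that by simp
  qed
  have si: "set_integrable lebesgue {x..y} (\<lambda>u. r u J * exp (- R u))" if "0 \<le> x" for x y
  proof (rule set_integrable_bound[OF rate_integrable[of "\<lambda>_. J" x y]])
    show "AE u in lebesgue. u \<in> {x..y} \<longrightarrow> norm (r u J * exp (- R u)) \<le> norm (r u J)"
      using R_nonneg that r_nonneg by (auto intro!: AE_I2 simp: abs_mult mult_left_le)
  qed (auto simp: set_borel_measurable_def)
  have F_diff: "F y - F x = (LINT u:{x..y}|lebesgue. r u J * exp (- R u))" if "0 \<le> x" "x \<le> y" for x y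
  proof -
    have "(LINT u:{x..y}|lebesgue. r u J * exp (- R u)) = (LINT u:{x<..y}|lebesgue. r u J * exp (- R u))"
      by (rule set_integral_discrete_difference[where X = "{x}"]) auto
    moreover have "(LINT u:{0..x} \<union> {x<..y}|lebesgue. r u J * exp (- R u))
        = (LINT u:{0..x}|lebesgue. r u J * exp (- R u)) + (LINT u:{x<..y}|lebesgue. r u J * exp (- R u))"
      by (rule set_integral_Un) (use that in \<open>auto intro: si set_integrable_subset[OF si[of x y]]\<close>)
    moreover have "{0..x} \<union> {x<..y} = {0..y}" using that by auto
    ultimately show ?thesis by (simp add: F_def)
  qed
  have quad: "\<bar>D y - D x\<bar> \<le> rM\<^sup>2 * \<bar>y - x\<bar>\<^sup>2" if "0 \<le> x" "x \<le> y" for x y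
  proof -
    define \<Delta> where "\<Delta> = R y - R x"
    have \<Delta>: "0 \<le> \<Delta>" using R_mono[OF that] by (simp add: \<Delta>_def)
    have \<Delta>_le: "\<Delta> \<le> rM * (y - x)"
      using R_diff[OF that] rate_integral_bounds(2)[of "\<lambda>_. J" x y] that by (simp add: \<Delta>_def)
    have "(LINT u:{x..y}|lebesgue. exp (- R y) * r u J) \<le> (LINT u:{x..y}|lebesgue. r u J * exp (- R u))"
    proof (rule set_integral_mono)
      show "set_integrable lebesgue {x..y} (\<lambda>u. exp (- R y) * r u J)"
        by (intro set_integrable_mult_right rate_integrable) simp
      show "exp (- R y) * r u J \<le> r u J * exp (- R u)" if "u \<in> {x..y}" for u
        using R_mono[of u y] r_nonneg[of u J] that \<open>0 \<le> x\<close> by (simp add: mult.commute mult_left_mono)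
    qed (use that si in auto)
    then have 1: "exp (- R y) * \<Delta> \<le> F y - F x"
      using that by (simp add: F_diff \<Delta>_def R_diff)
    have "(LINT u:{x..y}|lebesgue. r u J * exp (- R u)) \<le> (LINT u:{x..y}|lebesgue. exp (- R x) * r u J)"
    proof (rule set_integral_mono)
      show "set_integrable lebesgue {x..y} (\<lambda>u. exp (- R x) * r u J)"
        by (intro set_integrable_mult_right rate_integrable) simp
      show "r u J * exp (- R u) \<le> exp (- R x) * r u J" if "u \<in> {x..y}" for u
        using R_mono[of x u] r_nonneg[of u J] that \<open>0 \<le> x\<close> by (simp add: mult.commute mult_left_mono)
    qed (use that si in auto)
    then have 2: "F y - F x \<le> exp (- R x) * \<Delta>"
      using that by (simp add: F_diff \<Delta>_def R_diff)
    have ey: "exp (- R y) = exp (- R x) * exp (- \<Delta>)" by (simp add: \<Delta>_def flip: exp_add)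
    have ex: "exp (- R x) = exp (- R y) * exp \<Delta>" by (simp add: \<Delta>_def flip: exp_add)
    have e1: "exp (- R x) * (1 - exp (- \<Delta>)) \<le> exp (- R x) * \<Delta>"
      using exp_ge_add_one_self[of "- \<Delta>"] by (intro mult_left_mono) auto
    have e2: "exp (- R y) * \<Delta> \<le> exp (- R y) * (exp \<Delta> - 1)"
    proof (rule mult_left_mono)
      show "\<Delta> \<le> exp \<Delta> - 1" using exp_ge_add_one_self[of "\<Delta>"] by linarith
    qed simp
    have 3: "exp (- R x) - exp (- R y) \<le> exp (- R x) * \<Delta>" using e1 ey by (simp add: algebra_simps)
    have 4: "exp (- R y) * \<Delta> \<le> exp (- R x) - exp (- R y)" using e2 ex by (simp add: algebra_simps)
    have "\<bar>D y - D x\<bar> \<le> (exp (- R x) - exp (- R y)) * \<Delta>"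
      using 1 2 3 4 by (simp add: D_def abs_le_iff algebra_simps)
    also have "\<dots> \<le> (exp (- R x) * \<Delta>) * \<Delta>" using 3 \<Delta> by (intro mult_right_mono)
    also have "\<dots> \<le> (1 * \<Delta>) * \<Delta>"
      using \<Delta> R_nonneg[OF that(1)] by (intro mult_right_mono) auto
    also have "\<dots> \<le> (rM * (y - x)) * (rM * (y - x))"
      using \<Delta> \<Delta>_le by (simp add: mult_mono)
    finally show ?thesis by (simp add: power2_eq_square algebra_simps)
  qed
  have "(D has_field_derivative 0) (at x within {0..})" if x: "x \<in> {0..}" for x
    unfolding has_field_derivative_iff
  proof (rule Lim_null_comparison)
    have "\<forall>\<^sub>F y in at x within {0..}. y \<in> {0..} \<and> y \<noteq> x"
      by (simp add: eventually_at_filter)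
    then show "\<forall>\<^sub>F y in at x within {0..}. norm ((D y - D x) / (y - x)) \<le> rM\<^sup>2 * \<bar>y - x\<bar>"
    proof eventually_elim
      case (elim y)
      have "\<bar>D y - D x\<bar> \<le> rM\<^sup>2 * \<bar>y - x\<bar>\<^sup>2"
        using quad[of x y] quad[of y x] elim x by (cases "x \<le> y") (auto simp: abs_minus_commute)
      then show ?case using elim by (simp add: abs_divide divide_le_eq power2_eq_square mult.assoc)
    qed
    show "((\<lambda>y. rM\<^sup>2 * \<bar>y - x\<bar>) \<longlongrightarrow> 0) (at x within {0..})"
      by (auto intro!: tendsto_eq_intros)
  qed
  then obtain c where c: "\<And>x. x \<in> {0..} \<Longrightarrow> D x = c"
    using has_field_derivative_zero_constant[of "{0..}" D] by (auto simp: convex_real_interval)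
  have "F 0 = (LINT u:{}|lebesgue. r u J * exp (- R u))"
    unfolding F_def by (rule set_integral_discrete_difference[where X = "{0}"]) auto
  then have "D 0 = 1" by (simp add: D_def R0 set_lebesgue_integral_def)
  then show ?thesis using c[of x] c[of 0] assms by (simp add: D_def F_def R_def)
qed

lemma survival_integral_tendsto:
  assumes [measurable]: "\<And>j. f j \<in> borel_measurable lebesgue" "g \<in> borel_measurable lebesgue"
    and bound: "\<And>j x. 0 < x \<Longrightarrow> \<bar>f j x\<bar> \<le> C * exp (- r0 * x)"
    and lim: "\<And>x. 0 < x \<Longrightarrow> (\<lambda>j. f j x) \<longlonglongrightarrow> g x"
  shows "(\<lambda>j. LINT x:{0<..}|lebesgue. f j x) \<longlonglongrightarrow> (LINT x:{0<..}|lebesgue. g x)"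
  unfolding set_lebesgue_integral_def
proof (rule integral_dominated_convergence[where w = "\<lambda>x. indicator {0<..} x *\<^sub>R (C * exp (- r0 * x))"])
  show "integrable lebesgue (\<lambda>x. indicator {0<..} x *\<^sub>R (C * exp (- r0 * x)))"
    using set_integrable_mult_right[OF exp_neg_integrable[OF r0_pos]]
    unfolding set_integrable_def by blast
qed (use bound lim in \<open>auto simp: indicator_def\<close>)

text \<open>
Everybody discharges eventually. With the normalisation of \<^const>\<open>nbar\<close> this says that
\<open>Phi r J\<close> is the total discharge rate of the stationary density, which is why one delay period
turns the activity \<open>J\<close> into \<open>Phi r J\<close>.
\<close>

lemma renewal_flux:
  "(LINT x:{0<..}|lebesgue. r x J * exp (- R_int r x J)) = 1"
proof (rule LIMSEQ_unique)
  let ?f = "\<lambda>j x. indicator {0..real j} x * (r x J * exp (- R_int r x J))"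
  have bnd: "\<bar>?f j x\<bar> \<le> rM * exp (- r0 * x)" if "0 < x" for j x
    using r_nonneg[of x J] r_le[of x J] rM_pos R_int_ge[of x J] that
    by (auto simp: indicator_def intro!: mult_mono)
  show "(\<lambda>j. LINT x:{0<..}|lebesgue. ?f j x) \<longlonglongrightarrow> (LINT x:{0<..}|lebesgue. r x J * exp (- R_int r x J))"
  proof (rule survival_integral_tendsto[OF _ _ bnd])
    fix x :: real assume "0 < x"
    have "\<forall>\<^sub>F j in sequentially. x \<le> real j"
      using filterlim_real_sequentially by (simp add: filterlim_at_top)
    then have "\<forall>\<^sub>F j in sequentially. ?f j x = r x J * exp (- R_int r x J)"
      by eventually_elim (use \<open>0 < x\<close> in simp)
    then show "(\<lambda>j. ?f j x) \<longlonglongrightarrow> r x J * exp (- R_int r x J)" by (rule tendsto_eventually)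
  qed auto
  have eq: "(LINT x:{0<..}|lebesgue. ?f j x) = 1 - exp (- R_int r (real j) J)" for j
  proof -
    have "(LINT x:{0<..}|lebesgue. ?f j x) = (LINT x:{0<..real j}|lebesgue. r x J * exp (- R_int r x J))"
      unfolding set_lebesgue_integral_def
      by (rule Bochner_Integration.integral_cong) (auto simp: indicator_def)
    also have "\<dots> = (LINT x:{0..real j}|lebesgue. r x J * exp (- R_int r x J))"
      by (rule set_integral_discrete_difference[where X = "{0}"]) auto
    finally show ?thesis by (simp add: survival_flux_antiderivative)
  qed
  have "(\<lambda>j. exp (- R_int r (real j) J)) \<longlonglongrightarrow> 0"
  proof (rule tendsto_sandwich[of "\<lambda>_. 0" _ _ "\<lambda>j. exp (- (r0 * real j))"])
    have "filterlim (\<lambda>j. r0 * real j) at_top sequentially"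
      using r0_pos by (intro filterlim_tendsto_pos_mult_at_top[OF tendsto_const] filterlim_real_sequentially)
    then show "(\<lambda>j. exp (- (r0 * real j))) \<longlonglongrightarrow> 0"
      by (intro filterlim_compose[OF exp_at_bot]) (simp add: filterlim_uminus_at_bot)
  qed (auto simp: R_int_ge)
  then show "(\<lambda>j. LINT x:{0<..}|lebesgue. ?f j x) \<longlonglongrightarrow> 1"
    unfolding eq using tendsto_diff[OF tendsto_const[of 1]] by fastforce
qed

lemma rate_exp_integrable: "set_integrable lebesgue {0<..} (\<lambda>x. r x J * exp (- R_int r x J))"
  by (rule survival_integrable[where C = rM])
    (use r_nonneg r_le rM_pos R_int_ge[of _ J] in \<open>auto intro!: mult_mono\<close>)

lemma Phi_bounds: "r0 \<le> Phi r J" "Phi r J \<le> rM"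
  and Phi_mass: "Phi r J * (LINT x:{0<..}|lebesgue. exp (- R_int r x J)) = 1"
proof -
  let ?Z = "LINT x:{0<..}|lebesgue. exp (- R_int r x J)"
  have "(LINT x:{0<..}|lebesgue. r x J * exp (- R_int r x J)) \<le> (LINT x:{0<..}|lebesgue. rM * exp (- R_int r x J))"
    by (intro set_integral_mono rate_exp_integrable set_integrable_mult_right exp_R_int_integrable)
      (auto simp: r_le)
  then have 1: "1 \<le> rM * ?Z" by (simp add: renewal_flux)
  have "(LINT x:{0<..}|lebesgue. r0 * exp (- R_int r x J)) \<le> (LINT x:{0<..}|lebesgue. r x J * exp (- R_int r x J))"
    by (intro set_integral_mono rate_exp_integrable set_integrable_mult_right exp_R_int_integrable)
      (auto simp: r_ge)
  then have 2: "r0 * ?Z \<le> 1" by (simp add: renewal_flux)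
  have Z: "0 < ?Z" using 1 rM_pos by (smt (verit) mult_nonneg_nonpos)
  show "r0 \<le> Phi r J" "Phi r J \<le> rM" "Phi r J * ?Z = 1"
    using 1 2 Z by (simp_all add: Phi_def field_simps)
qed

lemma nbar_integrable: "set_integrable lebesgue {0<..} (\<lambda>x. nbar r x J)"
  unfolding nbar_def by (intro set_integrable_mult_right exp_R_int_integrable)

lemma nbar_mass: "(LINT x:{0<..}|lebesgue. nbar r x J) = 1"
  unfolding nbar_def by (simp add: Phi_mass)

lemma nbar_nonneg: "0 \<le> nbar r x J"
  using Phi_bounds[of J] r0_pos by (simp add: nbar_def)

lemma nbar_flux: "(LINT x:{0<..}|lebesgue. r x J * nbar r x J) = Phi r J"
proof -
  have "(LINT x:{0<..}|lebesgue. r x J * nbar r x J)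
      = (LINT x:{0<..}|lebesgue. Phi r J * (r x J * exp (- R_int r x J)))"
    by (simp add: nbar_def mult.left_commute)
  then show ?thesis by (simp add: renewal_flux)
qed

end

context age_rate begin

section \<open>Contraction towards the stationary state\<close>

text \<open>
Here \<open>b y\<close> is the delayed activity seen \<open>y\<close> time units ago, so an individual of present age \<open>x\<close>
saw \<open>b (x - u)\<close> at age \<open>u\<close>.
\<close>

definition surv :: "(real \<Rightarrow> real) \<Rightarrow> real \<Rightarrow> real" where
  "surv b x = exp (- hazard (\<lambda>u. b (x - u)) x)"

lemma borel_measurable_reflect:
  fixes x :: real and b :: "real \<Rightarrow> real"
  assumes "b \<in> borel_measurable lebesgue"
  shows "(\<lambda>u. b (x - u)) \<in> borel_measurable lebesgue"
  using borel_measurable_lebesgue_affine[OF assms, of "-1" x] by simp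

lemma surv_measurable [measurable]:
  "b \<in> borel_measurable lebesgue \<Longrightarrow> surv b \<in> borel_measurable lebesgue"
  using hazard_measurable[of b] by (simp add: surv_def[abs_def])

lemma surv_pos: "0 < surv b x"
  by (simp add: surv_def)

lemma surv_le:
  "b \<in> borel_measurable lebesgue \<Longrightarrow> 0 \<le> x \<Longrightarrow> surv b x \<le> exp (- r0 * x)"
  using hazard_ge[OF borel_measurable_reflect[of b x], of x] by (simp add: surv_def)

lemma surv_tendsto:
  assumes "\<And>j. b j \<in> borel_measurable lebesgue"
    and "\<And>y. 0 \<le> y \<Longrightarrow> (\<lambda>j. b j y) \<longlonglongrightarrow> J" and "0 \<le> x"
  shows "(\<lambda>j. surv (b j) x) \<longlonglongrightarrow> exp (- R_int r x J)"
  unfolding surv_def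
  by (intro tendsto_intros hazard_tendsto) (auto intro: borel_measurable_reflect assms)

end

text \<open>
Snapshots at times \<open>t j\<close> of a sequence of solutions, described from the present backwards: \<open>a j x\<close>
is the activity and \<open>b j x\<close> the delayed activity, both \<open>x\<close> time units ago. The density at the ages
\<open>x < t j\<close> comes from discharges \<open>x\<close> time units ago; the remaining ages descend from the initial
datum and carry exponentially little mass. The delayed activity settles at \<open>J\<close>.
\<close>

locale characteristic_profiles = age_rate +
  fixes a b :: "nat \<Rightarrow> real \<Rightarrow> real" and n :: "nat \<Rightarrow> real \<Rightarrow> real" and t :: "nat \<Rightarrow> real" and J :: real
  assumes a_meas: "\<And>j. a j \<in> borel_measurable lebesgue"
    and b_meas: "\<And>j. b j \<in> borel_measurable lebesgue"
    and a_range: "\<And>j x. a j x \<in> {0..rM}"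
    and t_nonneg: "\<And>j. 0 \<le> t j"
    and t_lim: "filterlim t at_top sequentially"
    and n_int: "\<And>j. set_integrable lebesgue {0<..} (n j)"
    and n_nonneg: "\<And>j. AE x in lebesgue. 0 < x \<longrightarrow> 0 \<le> n j x"
    and n_mass: "\<And>j. (LINT x:{0<..}|lebesgue. n j x) = 1"
    and n_eq: "\<And>j. AE x in lebesgue. 0 < x \<longrightarrow> x < t j \<longrightarrow> n j x = a j x * surv (b j) x"
    and n_tail: "\<And>j. (LINT x:{0<..}|lebesgue. indicator {t j..} x * n j x) \<le> exp (- r0 * t j)"
    and b_lim: "\<And>y. 0 \<le> y \<Longrightarrow> (\<lambda>j. b j y) \<longlonglongrightarrow> J"
begin

declare a_meas [measurable] b_meas [measurable]

lemma tail_tendsto: "(\<lambda>j. exp (- r0 * t j)) \<longlonglongrightarrow> 0"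
proof -
  have "filterlim (\<lambda>j. r0 * t j) at_top sequentially"
    using r0_pos by (intro filterlim_tendsto_pos_mult_at_top[OF tendsto_const] t_lim)
  then show ?thesis
    by (intro filterlim_compose[OF exp_at_bot]) (simp add: filterlim_uminus_at_bot)
qed

lemma eventually_before: "\<forall>\<^sub>F j in sequentially. x < t j"
  using t_lim by (simp add: filterlim_at_top_dense)

lemma tail_integrable: "set_integrable lebesgue {0<..} (\<lambda>x. indicator {t j..} x * n j x)"
proof -
  have "integrable lebesgue (\<lambda>x. indicator {t j..} x *\<^sub>R (indicator {0<..} x *\<^sub>R n j x))"
    by (rule integrable_mult_indicator) (use n_int[of j] in \<open>simp_all add: set_integrable_def\<close>)
  then show ?thesis by (simp add: set_integrable_def mult.left_commute)
qed

lemma flux_integrable: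
  "set_integrable lebesgue {0<..} (\<lambda>x. r x c * n j x)"
proof (rule set_integrable_bound)
  show "set_integrable lebesgue {0<..} (\<lambda>x. rM * n j x)" using n_int by simp
  have [measurable]: "(\<lambda>x. indicator {0<..} x *\<^sub>R n j x) \<in> borel_measurable lebesgue"
    using n_int unfolding set_integrable_def by (rule borel_measurable_integrable)
  have "(\<lambda>x. r x c * (indicator {0<..} x *\<^sub>R n j x)) \<in> borel_measurable lebesgue" by measurable
  then show "set_borel_measurable lebesgue {0<..} (\<lambda>x. r x c * n j x)"
    by (simp add: set_borel_measurable_def mult.left_commute)
  show "AE x in lebesgue. x \<in> {0<..} \<longrightarrow> norm (r x c * n j x) \<le> norm (rM * n j x)"
    using r_nonneg r_le rM_pos by (auto simp: abs_mult intro!: mult_right_mono)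
qed

text \<open>
Ages up to \<open>t j\<close> are estimated through \<open>U\<close>, older ages by their total mass.
\<close>

lemma integral_split_bound:
  fixes G U :: "real \<Rightarrow> real"
  assumes "set_integrable lebesgue {0<..} G" "set_integrable lebesgue {0<..} U" "0 \<le> c"
    and "AE x in lebesgue. 0 < x \<longrightarrow> \<bar>G x\<bar> \<le> U x + c * (indicator {t j..} x * n j x)"
  shows "(LINT x:{0<..}|lebesgue. \<bar>G x\<bar>) \<le> (LINT x:{0<..}|lebesgue. U x) + c * exp (- r0 * t j)"
proof -
  have "(LINT x:{0<..}|lebesgue. \<bar>G x\<bar>) \<le> (LINT x:{0<..}|lebesgue. U x + c * (indicator {t j..} x * n j x))"
    using assms tail_integrable[of j] by (intro set_integral_mono_AE set_integrable_abs) auto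
  also have "\<dots> = (LINT x:{0<..}|lebesgue. U x) + c * (LINT x:{0<..}|lebesgue. indicator {t j..} x * n j x)"
    using assms tail_integrable[of j] by (simp add: set_integral_add)
  finally show ?thesis using mult_left_mono[OF n_tail[of j] \<open>0 \<le> c\<close>] by linarith
qed

text \<open>
The contraction factor comes from the mass constraint. As the density has mass 1, \<open>r0\<close> can be
subtracted from the rate on both sides without changing the difference of the activities: the
present error is the integral of the past errors against \<open>(r - r0)\<close> times the survival function,
up to terms that vanish in the limit. That weight is nonnegative and its integral is
\<open>1 - r0 / Phi r J\<close>, because the flux of the survival function is 1 and its mass is \<open>1 / Phi r J\<close>.
\<close>

lemma activity_contraction:
  assumes \<delta>: "0 \<le> \<delta>"
    and a_lim: "\<And>x \<epsilon>. 0 < x \<Longrightarrow> 0 < \<epsilon> \<Longrightarrow> \<forall>\<^sub>F j in sequentially. \<bar>a j x - Phi r J\<bar> < \<delta> + \<epsilon>"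
    and "0 < \<epsilon>"
  shows "\<forall>\<^sub>F j in sequentially.
    \<bar>(LINT x:{0<..}|lebesgue. r x (b j 0) * n j x) - Phi r J\<bar> < (1 - r0 / Phi r J) * \<delta> + \<epsilon>"
proof -
  let ?I = "Phi r J"
  define P where "P x = (r x J - r0) * exp (- R_int r x J)" for x
  define Pj where "Pj j x = indicator {..<t j} x * ((r x (b j 0) - r0) * surv (b j) x)" for j x
  define U where "U j x = Pj j x * max \<bar>a j x - ?I\<bar> \<delta> + ?I * \<bar>Pj j x - P x\<bar>" for j x
  have I: "0 \<le> ?I" "?I \<le> rM" using Phi_bounds[of J] r0_pos by auto
  have [measurable]: "P \<in> borel_measurable lebesgue" "Pj j \<in> borel_measurable lebesgue"
      "U j \<in> borel_measurable lebesgue" for j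
    unfolding P_def[abs_def] Pj_def[abs_def] U_def[abs_def] by measurable
  have P_bd: "0 \<le> P x" "P x \<le> rM * exp (- r0 * x)" if "0 < x" for x
    using that r_ge[of x J] r_le[of x J] r0_pos rM_pos R_int_ge[of x J]
    by (auto simp: P_def intro!: mult_mono)
  have Pj_bd: "0 \<le> Pj j x" "Pj j x \<le> rM * exp (- r0 * x)" if "0 < x" for j x
  proof -
    show "0 \<le> Pj j x" using r_ge[of x "b j 0"] surv_pos[of "b j" x] by (simp add: Pj_def)
    have "(r x (b j 0) - r0) * surv (b j) x \<le> rM * exp (- r0 * x)"
      using r_ge[of x "b j 0"] r_le[of x "b j 0"] r0_pos rM_pos surv_pos[of "b j" x]
        surv_le[OF b_meas, of x j] that by (intro mult_mono) auto
    then show "Pj j x \<le> rM * exp (- r0 * x)" using rM_pos by (simp add: Pj_def indicator_def)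
  qed
  have Pj_lim: "(\<lambda>j. Pj j x) \<longlonglongrightarrow> P x" if "0 < x" for x
  proof -
    have "(\<lambda>j. (r x (b j 0) - r0) * surv (b j) x) \<longlonglongrightarrow> P x"
      unfolding P_def using that
      by (intro tendsto_intros isCont_tendsto_compose[OF r_cont] b_lim surv_tendsto) auto
    moreover have "\<forall>\<^sub>F j in sequentially. (r x (b j 0) - r0) * surv (b j) x = Pj j x"
      using eventually_before[of x] by eventually_elim (simp add: Pj_def)
    ultimately show ?thesis by (rule Lim_transform_eventually)
  qed
  have U_bd: "\<bar>U j x\<bar> \<le> (rM * (rM + \<delta>) + rM * rM) * exp (- r0 * x)" if "0 < x" for j x
  proof -
    let ?e = "exp (- r0 * x)"
    have "\<bar>a j x - ?I\<bar> \<le> rM" using a_range[of j x] I by auto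
    then have 1: "Pj j x * max \<bar>a j x - ?I\<bar> \<delta> \<le> (rM * ?e) * (rM + \<delta>)"
      using Pj_bd[OF that, of j] \<delta> rM_pos by (intro mult_mono) auto
    have "\<bar>Pj j x - P x\<bar> \<le> rM * ?e"
      using Pj_bd[OF that, of j] P_bd[OF that] by linarith
    then have 2: "?I * \<bar>Pj j x - P x\<bar> \<le> rM * (rM * ?e)"
      using I rM_pos by (intro mult_mono) auto
    have "0 \<le> U j x" using Pj_bd[OF that, of j] \<delta> I by (auto simp: U_def)
    then have "\<bar>U j x\<bar> = U j x" by simp
    also have "\<dots> \<le> (rM * ?e) * (rM + \<delta>) + rM * (rM * ?e)"
      unfolding U_def by (rule add_mono[OF 1 2])
    finally show ?thesis by (simp add: algebra_simps)
  qed
  have U_int: "set_integrable lebesgue {0<..} (U j)" for j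
    by (rule survival_integrable[OF _ U_bd]) simp_all
  have U_lim: "(\<lambda>j. LINT x:{0<..}|lebesgue. U j x) \<longlonglongrightarrow> (LINT x:{0<..}|lebesgue. \<delta> * P x)"
  proof (rule survival_integral_tendsto[OF _ _ U_bd])
    fix x :: real assume x: "0 < x"
    \<comment> \<open>The past errors need not converge; their maximum with the bound does.\<close>
    have "(\<lambda>j. max \<bar>a j x - ?I\<bar> \<delta>) \<longlonglongrightarrow> \<delta>"
    proof (rule tendstoI)
      fix e :: real assume "0 < e"
      from a_lim[OF x this] show "\<forall>\<^sub>F j in sequentially. dist (max \<bar>a j x - ?I\<bar> \<delta>) \<delta> < e"
        by eventually_elim (use \<open>0 < e\<close> in \<open>auto simp: dist_real_def max_def\<close>)
    qed
    then have "(\<lambda>j. U j x) \<longlonglongrightarrow> P x * \<delta> + ?I * \<bar>P x - P x\<bar>"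
      unfolding U_def by (intro tendsto_intros Pj_lim x)
    then show "(\<lambda>j. U j x) \<longlonglongrightarrow> \<delta> * P x" by (simp add: mult.commute)
  qed auto
  have P_int: "(LINT x:{0<..}|lebesgue. \<delta> * P x) = (1 - r0 / ?I) * \<delta>"
  proof -
    have "(LINT x:{0<..}|lebesgue. P x)
        = (LINT x:{0<..}|lebesgue. r x J * exp (- R_int r x J) - r0 * exp (- R_int r x J))"
      by (simp add: P_def left_diff_distrib)
    also have "\<dots> = 1 - r0 * (LINT x:{0<..}|lebesgue. exp (- R_int r x J))"
      using rate_exp_integrable[of J] exp_R_int_integrable[of J] by (simp add: set_integral_diff renewal_flux)
    also have "\<dots> = 1 - r0 / ?I" by (simp add: Phi_def divide_inverse)
    finally show ?thesis by simp
  qed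
  have "(\<lambda>j. (LINT x:{0<..}|lebesgue. U j x) + rM * exp (- r0 * t j))
      \<longlonglongrightarrow> (1 - r0 / ?I) * \<delta> + rM * 0"
    using U_lim unfolding P_int by (intro tendsto_add tendsto_mult tendsto_const tail_tendsto)
  then have "\<forall>\<^sub>F j in sequentially. (LINT x:{0<..}|lebesgue. U j x) + rM * exp (- r0 * t j)
      < (1 - r0 / ?I) * \<delta> + \<epsilon>"
    using \<open>0 < \<epsilon>\<close> by (intro order_tendstoD) auto
  then show ?thesis
  proof eventually_elim
    case (elim j)
    define G where "G x = (r x (b j 0) - r0) * n j x - (r x J - r0) * nbar r x J" for x
    have ni: "set_integrable lebesgue {0<..} (\<lambda>x. (r x (b j 0) - r0) * n j x)"
      using flux_integrable[of "b j 0" j] n_int[of j] by (simp add: left_diff_distrib set_integral_diff)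
    have rn: "set_integrable lebesgue {0<..} (\<lambda>x. r x J * nbar r x J)"
      using set_integrable_mult_right[OF rate_exp_integrable[of J], where a = ?I]
      by (simp add: nbar_def mult.left_commute)
    then have nb: "set_integrable lebesgue {0<..} (\<lambda>x. (r x J - r0) * nbar r x J)"
      using nbar_integrable[of J] by (simp add: left_diff_distrib set_integral_diff)
    have Gi: "set_integrable lebesgue {0<..} G"
      unfolding G_def using ni nb by (rule set_integral_diff)
    have "(LINT x:{0<..}|lebesgue. G x)
        = (LINT x:{0<..}|lebesgue. (r x (b j 0) - r0) * n j x) - (LINT x:{0<..}|lebesgue. (r x J - r0) * nbar r x J)"
      unfolding G_def using ni nb by (rule set_integral_diff)
    also have "(LINT x:{0<..}|lebesgue. (r x (b j 0) - r0) * n j x)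
        = (LINT x:{0<..}|lebesgue. r x (b j 0) * n j x) - r0"
      using flux_integrable[of "b j 0" j] n_int[of j] by (simp add: left_diff_distrib set_integral_diff n_mass)
    also have "(LINT x:{0<..}|lebesgue. (r x J - r0) * nbar r x J) = ?I - r0"
      using rn nbar_integrable[of J] by (simp add: left_diff_distrib set_integral_diff nbar_mass nbar_flux)
    finally have "\<bar>(LINT x:{0<..}|lebesgue. r x (b j 0) * n j x) - ?I\<bar> = \<bar>LINT x:{0<..}|lebesgue. G x\<bar>"
      by simp
    also have "\<dots> \<le> (LINT x:{0<..}|lebesgue. \<bar>G x\<bar>)"
      using set_integral_norm_bound[OF Gi] by simp
    also have "\<dots> \<le> (LINT x:{0<..}|lebesgue. U j x) + rM * exp (- r0 * t j)"
    proof (rule integral_split_bound[OF Gi U_int])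
      show "AE x in lebesgue. 0 < x \<longrightarrow> \<bar>G x\<bar> \<le> U j x + rM * (indicator {t j..} x * n j x)"
        using n_eq[of j] n_nonneg[of j]
      proof (eventually_elim, intro impI)
        fix x :: real
        assume x: "0 < x" and ne: "0 < x \<longrightarrow> x < t j \<longrightarrow> n j x = a j x * surv (b j) x"
          and nn: "0 < x \<longrightarrow> 0 \<le> n j x"
        have nb: "(r x J - r0) * nbar r x J = ?I * P x" by (simp add: nbar_def P_def)
        show "\<bar>G x\<bar> \<le> U j x + rM * (indicator {t j..} x * n j x)"
        proof (cases "x < t j")
          case True
          then have "G x = Pj j x * (a j x - ?I) + ?I * (Pj j x - P x)"
            using ne x unfolding G_def nb by (simp add: Pj_def algebra_simps)
          then have "\<bar>G x\<bar> \<le> Pj j x * \<bar>a j x - ?I\<bar> + ?I * \<bar>Pj j x - P x\<bar>"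
            using Pj_bd(1)[OF x, of j] I(1)
              abs_triangle_ineq[of "Pj j x * (a j x - ?I)" "?I * (Pj j x - P x)"]
            by (simp add: abs_mult)
          also have "\<dots> \<le> U j x"
            unfolding U_def using Pj_bd(1)[OF x, of j] I(1) by (intro add_mono mult_left_mono) auto
          finally show ?thesis using True by simp
        next
          case False
          then have P0: "Pj j x = 0" by (simp add: Pj_def)
          have "(r x (b j 0) - r0) * n j x \<le> rM * n j x"
            using nn x r_le[of x "b j 0"] r0_pos by (intro mult_right_mono) auto
          moreover have "0 \<le> (r x (b j 0) - r0) * n j x"
            using nn x r_ge[of x "b j 0"] by simp
          moreover have "0 \<le> ?I * P x" using I P_bd[OF x] by simp
          ultimately have "\<bar>G x\<bar> \<le> ?I * P x + rM * n j x" unfolding G_def nb by linarith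
          then show ?thesis using False P_bd(1)[OF x] by (simp add: U_def P0)
        qed
      qed
    qed (use rM_pos in simp)
    finally show ?case using elim by linarith
  qed
qed

lemma density_tendsto:
  assumes a_lim: "\<And>x. 0 < x \<Longrightarrow> (\<lambda>j. a j x) \<longlonglongrightarrow> Phi r J"
  shows "(\<lambda>j. L1_norm (\<lambda>x. n j x - nbar r x J)) \<longlonglongrightarrow> 0"
proof -
  define q where "q j x = indicator {..<t j} x * (a j x * surv (b j) x)" for j x
  define U where "U j x = \<bar>q j x - nbar r x J\<bar>" for j x
  have [measurable]: "q j \<in> borel_measurable lebesgue" "(\<lambda>x. nbar r x J) \<in> borel_measurable lebesgue"
      "U j \<in> borel_measurable lebesgue" for j
    unfolding q_def[abs_def] nbar_def U_def[abs_def] by measurable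
  have U_bd: "\<bar>U j x\<bar> \<le> rM * exp (- r0 * x)" if "0 < x" for j x
  proof -
    have "a j x * surv (b j) x \<le> rM * exp (- r0 * x)"
      using a_range[of j x] rM_pos surv_pos[of "b j" x] surv_le[OF b_meas, of x j] that
      by (intro mult_mono) auto
    moreover have "0 \<le> a j x * surv (b j) x" using a_range[of j x] surv_pos[of "b j" x] by simp
    ultimately have "0 \<le> q j x" "q j x \<le> rM * exp (- r0 * x)"
      using rM_pos by (auto simp: q_def indicator_def)
    moreover have "nbar r x J \<le> rM * exp (- r0 * x)"
      unfolding nbar_def using Phi_bounds[of J] r0_pos rM_pos R_int_ge[of x J] that
      by (intro mult_mono) auto
    ultimately show ?thesis using nbar_nonneg[of x J] by (auto simp: U_def abs_le_iff)
  qed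
  have U_int: "set_integrable lebesgue {0<..} (U j)" for j
    by (rule survival_integrable[OF _ U_bd]) simp_all
  have U_lim: "(\<lambda>j. LINT x:{0<..}|lebesgue. U j x) \<longlonglongrightarrow> (LINT x:{0::real<..}|lebesgue. (0::real))"
  proof (rule survival_integral_tendsto[OF _ _ U_bd])
    fix x :: real assume x: "0 < x"
    have "(\<lambda>j. a j x * surv (b j) x) \<longlonglongrightarrow> nbar r x J"
      unfolding nbar_def using x by (intro tendsto_intros a_lim surv_tendsto b_lim) auto
    moreover have "\<forall>\<^sub>F j in sequentially. a j x * surv (b j) x = q j x"
      using eventually_before[of x] by eventually_elim (simp add: q_def)
    ultimately have "(\<lambda>j. q j x) \<longlonglongrightarrow> nbar r x J" by (rule Lim_transform_eventually)
    then have "(\<lambda>j. U j x) \<longlonglongrightarrow> \<bar>nbar r x J - nbar r x J\<bar>"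
      unfolding U_def by (intro tendsto_intros)
    then show "(\<lambda>j. U j x) \<longlonglongrightarrow> 0" by simp
  qed auto
  show ?thesis
  proof (rule tendsto_sandwich)
    show "\<forall>\<^sub>F j in sequentially. 0 \<le> L1_norm (\<lambda>x. n j x - nbar r x J)"
      by (simp add: L1_norm_nonneg)
    show "\<forall>\<^sub>F j in sequentially. L1_norm (\<lambda>x. n j x - nbar r x J)
        \<le> (LINT x:{0<..}|lebesgue. U j x) + 1 * exp (- r0 * t j)"
    proof (intro always_eventually allI)
      fix j
      show "L1_norm (\<lambda>x. n j x - nbar r x J) \<le> (LINT x:{0<..}|lebesgue. U j x) + 1 * exp (- r0 * t j)"
        unfolding L1_norm_def
      proof (rule integral_split_bound[OF _ U_int])
        show "set_integrable lebesgue {0<..} (\<lambda>x. n j x - nbar r x J)"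
          using n_int nbar_integrable by (rule set_integral_diff)
        show "AE x in lebesgue. 0 < x \<longrightarrow>
            \<bar>n j x - nbar r x J\<bar> \<le> U j x + 1 * (indicator {t j..} x * n j x)"
          using n_eq[of j] n_nonneg[of j]
        proof (eventually_elim, intro impI)
          fix x :: real
          assume "0 < x" and "0 < x \<longrightarrow> x < t j \<longrightarrow> n j x = a j x * surv (b j) x"
            and "0 < x \<longrightarrow> 0 \<le> n j x"
          then show "\<bar>n j x - nbar r x J\<bar> \<le> U j x + 1 * (indicator {t j..} x * n j x)"
            using nbar_nonneg[of x J] by (cases "x < t j") (auto simp: U_def q_def)
        qed
      qed simp
    qed
    show "(\<lambda>j. (LINT x:{0<..}|lebesgue. U j x) + 1 * exp (- r0 * t j)) \<longlonglongrightarrow> 0"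
      using tendsto_add[OF U_lim tail_tendsto] by simp
  qed auto
qed

end

context age_rate begin

section \<open>Induction over the delay windows\<close>

text \<open>
The properties of a delayed solution that the convergence proof uses, for an activity extended by
its initial value to all negative times. The initial datum enters only through the bound on the
mass of the ages \<open>x \<ge> t\<close>.
\<close>

definition regular_solution ::
    "real \<Rightarrow> real \<Rightarrow> (real \<Rightarrow> real \<Rightarrow> real) \<Rightarrow> (real \<Rightarrow> real) \<Rightarrow> bool" where
  "regular_solution I_ini d n I \<longleftrightarrow>
     I \<in> borel_measurable lebesgue \<and> (\<forall>t. I t \<in> {0..rM}) \<and> (\<forall>t<0. I t = I_ini) \<and>
     (\<forall>t\<ge>0. set_integrable lebesgue {0<..} (n t)) \<and>
     (\<forall>t\<ge>0. AE x in lebesgue. 0 < x \<longrightarrow> 0 \<le> n t x) \<and>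
     (\<forall>t\<ge>0. (LINT x:{0<..}|lebesgue. n t x) = 1) \<and>
     (\<forall>t\<ge>0. AE x in lebesgue. 0 < x \<longrightarrow> x < t \<longrightarrow>
        n t x = I (t - x) * surv (\<lambda>y. I (t - d - y)) x) \<and>
     (\<forall>t\<ge>0. (LINT x:{0<..}|lebesgue. indicator {t..} x * n t x) \<le> exp (- r0 * t)) \<and>
     (\<forall>t\<ge>0. I t = (LINT x:{0<..}|lebesgue. r x (I (t - d)) * n t x))"

end

text \<open>
Uniformity in the delay is expressed by sequences: \<open>s j\<close> is a time within a window of length
\<open>d j\<close>, and it recedes from the beginning of the window. Shifting such times back by a fixed amount
does not leave this class, which is what allows dominated convergence over a fixed age.
\<close>

definition late_in_window :: "(nat \<Rightarrow> real) \<Rightarrow> (nat \<Rightarrow> real) \<Rightarrow> bool" where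
  "late_in_window d s \<longleftrightarrow> (\<forall>j. 0 \<le> s j \<and> s j < d j) \<and> filterlim s at_top sequentially"

lemma late_in_window_shift:
  assumes "late_in_window d s" "0 \<le> x"
  shows "late_in_window d (\<lambda>j. max 0 (s j - x))"
    and "\<forall>\<^sub>F j in sequentially. max 0 (s j - x) = s j - x"
proof -
  have s: "0 \<le> s j" "s j < d j" for j using assms by (auto simp: late_in_window_def)
  have lim: "filterlim s at_top sequentially" using assms by (simp add: late_in_window_def)
  then have "\<forall>\<^sub>F j in sequentially. x \<le> s j" by (simp add: filterlim_at_top)
  then show ev: "\<forall>\<^sub>F j in sequentially. max 0 (s j - x) = s j - x" by eventually_elim simp
  have "filterlim (\<lambda>j. s j - x) at_top sequentially"
    using filterlim_tendsto_add_at_top[OF tendsto_const[of "- x"] lim] by simp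
  then have "filterlim (\<lambda>j. max 0 (s j - x)) at_top sequentially"
    using filterlim_cong[OF refl refl ev] by simp
  then show "late_in_window d (\<lambda>j. max 0 (s j - x))"
    using s assms(2) s(2)[THEN le_less_trans[OF s(1)]]
    unfolding late_in_window_def by (smt (verit))
qed

locale delayed_family = age_rate +
  fixes I_ini :: real and n :: "real \<Rightarrow> real \<Rightarrow> real \<Rightarrow> real" and I :: "real \<Rightarrow> real \<Rightarrow> real"
  assumes sol: "\<And>d. 0 < d \<Longrightarrow> regular_solution I_ini d (n d) (I d)"
begin

definition limit_activity :: "nat \<Rightarrow> real" where
  "limit_activity k = (Phi r ^^ k) I_ini"

lemma limit_activity_Suc: "limit_activity (Suc k) = Phi r (limit_activity k)"
  by (simp add: limit_activity_def)

text \<open>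
Window \<open>k\<close> consists of the times in \<open>[(k - 1) * d, k * d)\<close>; window 0 holds the initial history.
\<close>

definition window_converges :: "nat \<Rightarrow> bool" where
  "window_converges k \<longleftrightarrow> (\<forall>d s. late_in_window d s \<longrightarrow>
     (\<lambda>j. I (d j) (real k * d j + s j - d j)) \<longlonglongrightarrow> limit_activity k)"

lemma window_profiles:
  assumes W: "window_converges k" and ds: "late_in_window d s"
  defines "t \<equiv> \<lambda>j. real k * d j + s j"
  shows "characteristic_profiles r r0 rM (\<lambda>j x. I (d j) (t j - x)) (\<lambda>j y. I (d j) (t j - d j - y))
    (\<lambda>j. n (d j) (t j)) t (limit_activity k)"
proof -
  have s: "0 \<le> s j" "s j < d j" "0 < d j" for j
    using ds by (auto simp: late_in_window_def intro: le_less_trans)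
  have t: "0 \<le> t j" "s j \<le> t j" for j using s[of j] by (auto simp: t_def)
  note R = sol[OF s(3), unfolded regular_solution_def]
  have Im: "I (d j) \<in> borel_measurable lebesgue" for j using R by blast
  show ?thesis
  proof unfold_locales
    show "(\<lambda>x. I (d j) (t j - x)) \<in> borel_measurable lebesgue" for j
      by (rule borel_measurable_reflect[OF Im])
    show "(\<lambda>x. I (d j) (t j - d j - x)) \<in> borel_measurable lebesgue" for j
      by (rule borel_measurable_reflect[OF Im])
    show "filterlim t at_top sequentially"
    proof (rule filterlim_at_top_mono)
      show "filterlim s at_top sequentially" using ds by (simp add: late_in_window_def)
    qed (simp add: t)
    show "(\<lambda>j. I (d j) (t j - d j - y)) \<longlonglongrightarrow> limit_activity k" if "0 \<le> y" for y
    proof (rule Lim_transform_eventually)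
      show "(\<lambda>j. I (d j) (real k * d j + max 0 (s j - y) - d j)) \<longlonglongrightarrow> limit_activity k"
        using W late_in_window_shift(1)[OF ds that] unfolding window_converges_def by blast
      show "\<forall>\<^sub>F j in sequentially. I (d j) (real k * d j + max 0 (s j - y) - d j) = I (d j) (t j - d j - y)"
        using late_in_window_shift(2)[OF ds that] by eventually_elim (simp add: t_def algebra_simps)
    qed
    show "I (d j) (t j - x) \<in> {0..rM}" for j x
      using R[of j] by (elim conjE) simp
    show "AE x in lebesgue. 0 < x \<longrightarrow> x < t j \<longrightarrow>
        n (d j) (t j) x = I (d j) (t j - x) * surv (\<lambda>y. I (d j) (t j - d j - y)) x" for j
      using R[of j] t(1)[of j] by (elim conjE) simp
    show "set_integrable lebesgue {0<..} (n (d j) (t j))" for j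
      using R[of j] t(1)[of j] by (elim conjE) simp
    show "AE x in lebesgue. 0 < x \<longrightarrow> 0 \<le> n (d j) (t j) x" for j
      using R[of j] t(1)[of j] by (elim conjE) simp
    show "(LINT x:{0<..}|lebesgue. n (d j) (t j) x) = 1" for j
      using R[of j] t(1)[of j] by (elim conjE) simp
    show "(LINT x:{0<..}|lebesgue. indicator {t j..} x * n (d j) (t j) x) \<le> exp (- r0 * t j)" for j
      using R[of j] t(1)[of j] by (elim conjE) simp
  qed (rule t)
qed

lemma window_converges_0: "window_converges 0"
  unfolding window_converges_def
proof (intro allI impI)
  fix d s assume ds: "late_in_window d s"
  have "I (d j) (real 0 * d j + s j - d j) = I_ini" for j
  proof -
    have "0 \<le> s j" "s j < d j" using ds by (auto simp: late_in_window_def)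
    then show ?thesis using sol[of "d j"] by (auto simp: regular_solution_def)
  qed
  then show "(\<lambda>j. I (d j) (real 0 * d j + s j - d j)) \<longlonglongrightarrow> limit_activity 0"
    by (simp add: limit_activity_def)
qed

text \<open>
Inside a window the delayed activity is, by induction, close to a constant. Each application of
\<open>activity_contraction\<close> multiplies the error bound by the same factor, at the price of a longer
waiting time after the start of the window; in terms of sequences that price is invisible.
\<close>

lemma window_error_bound:
  assumes W: "window_converges k" and "late_in_window d s" and "0 < \<epsilon>"
  shows "\<forall>\<^sub>F j in sequentially. \<bar>I (d j) (real k * d j + s j) - limit_activity (Suc k)\<bar>
    < (1 - r0 / limit_activity (Suc k)) ^ m * rM + \<epsilon>"
  using assms(2-)
proof (induction m arbitrary: s \<epsilon>)
  case 0
  have s: "0 < d j" for j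
    using 0 by (auto simp: late_in_window_def intro: le_less_trans)
  have "\<bar>I (d j) (real k * d j + s j) - limit_activity (Suc k)\<bar> < rM + \<epsilon>" for j
  proof -
    have "I (d j) (real k * d j + s j) \<in> {0..rM}"
      using sol[OF s] unfolding regular_solution_def by blast
    then show ?thesis
      using Phi_bounds[of "limit_activity k"] r0_pos 0(2) by (auto simp: limit_activity_Suc)
  qed
  then show ?case by simp
next
  case (Suc m)
  let ?I = "limit_activity (Suc k)" and ?t = "\<lambda>j. real k * d j + s j"
  have s: "0 \<le> s j" "s j < d j" "0 < d j" for j
    using Suc.prems by (auto simp: late_in_window_def intro: le_less_trans)
  interpret characteristic_profiles r r0 rM "\<lambda>j x. I (d j) (?t j - x)" "\<lambda>j y. I (d j) (?t j - d j - y)"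
    "\<lambda>j. n (d j) (?t j)" ?t "limit_activity k"
    by (rule window_profiles[OF W Suc.prems(1)])
  have I: "r0 \<le> ?I" using Phi_bounds by (simp add: limit_activity_Suc)
  then have \<delta>: "0 \<le> (1 - r0 / ?I) ^ m * rM" using r0_pos rM_pos by simp
  have "\<forall>\<^sub>F j in sequentially.
      \<bar>(LINT x:{0<..}|lebesgue. r x (I (d j) (?t j - d j - 0)) * n (d j) (?t j) x) - Phi r (limit_activity k)\<bar>
      < (1 - r0 / Phi r (limit_activity k)) * ((1 - r0 / ?I) ^ m * rM) + \<epsilon>"
  proof (rule activity_contraction[OF \<delta> _ Suc.prems(2)])
    fix x e :: real assume "0 < x" "0 < e"
    then have x: "0 \<le> x" by simp
    show "\<forall>\<^sub>F j in sequentially. \<bar>I (d j) (?t j - x) - Phi r (limit_activity k)\<bar> < (1 - r0 / ?I) ^ m * rM + e"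
      using Suc.IH[OF late_in_window_shift(1)[OF Suc.prems(1) x] \<open>0 < e\<close>]
        late_in_window_shift(2)[OF Suc.prems(1) x]
      by eventually_elim (simp add: limit_activity_Suc algebra_simps)
  qed
  moreover have "I (d j) (?t j) = (LINT x:{0<..}|lebesgue. r x (I (d j) (?t j - d j - 0)) * n (d j) (?t j) x)" for j
    using sol[OF s(3)] t_nonneg[of j] unfolding regular_solution_def by simp
  ultimately show ?case by (simp add: limit_activity_Suc mult.assoc)
qed

lemma window_converges_Suc:
  assumes W: "window_converges k"
  shows "window_converges (Suc k)"
  unfolding window_converges_def
proof (intro allI impI tendstoI)
  fix d s :: "nat \<Rightarrow> real" and e :: real assume ds: "late_in_window d s" and e: "0 < e"
  let ?\<theta> = "1 - r0 / limit_activity (Suc k)"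
  have I: "r0 \<le> limit_activity (Suc k)" using Phi_bounds by (simp add: limit_activity_Suc)
  then have "0 \<le> ?\<theta>" "?\<theta> < 1" using r0_pos by auto
  then have "(\<lambda>m. ?\<theta> ^ m * rM) \<longlonglongrightarrow> 0 * rM"
    by (intro tendsto_intros LIMSEQ_realpow_zero) auto
  then have "\<forall>\<^sub>F m in sequentially. ?\<theta> ^ m * rM < e / 2"
    using e by (intro order_tendstoD) auto
  then obtain m where m: "?\<theta> ^ m * rM < e / 2"
    using eventually_happens trivial_limit_sequentially by blast
  have "\<forall>\<^sub>F j in sequentially. \<bar>I (d j) (real k * d j + s j) - limit_activity (Suc k)\<bar> < ?\<theta> ^ m * rM + e / 2"
    using e by (intro window_error_bound[OF W ds]) simp
  then show "\<forall>\<^sub>F j in sequentially. dist (I (d j) (real (Suc k) * d j + s j - d j)) (limit_activity (Suc k)) < e"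
    by eventually_elim (use m in \<open>simp add: dist_real_def algebra_simps\<close>)
qed

lemma window_converges: "window_converges k"
  by (induction k) (simp_all add: window_converges_0 window_converges_Suc)

lemma activity_tendsto:
  assumes "late_in_window d s"
  shows "(\<lambda>j. I (d j) (real k * d j + s j)) \<longlonglongrightarrow> limit_activity (Suc k)"
proof -
  have "(\<lambda>j. I (d j) (real (Suc k) * d j + s j - d j)) \<longlonglongrightarrow> limit_activity (Suc k)"
    using window_converges[of "Suc k"] assms unfolding window_converges_def by blast
  then show ?thesis by (simp add: algebra_simps)
qed

lemma solution_tendsto:
  assumes ds: "late_in_window d s"
  shows "(\<lambda>j. L1_norm (\<lambda>x. n (d j) (real k * d j + s j) x - nbar r x (limit_activity k))) \<longlonglongrightarrow> 0"
proof -
  let ?t = "\<lambda>j. real k * d j + s j"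
  interpret characteristic_profiles r r0 rM "\<lambda>j x. I (d j) (?t j - x)" "\<lambda>j y. I (d j) (?t j - d j - y)"
    "\<lambda>j. n (d j) (?t j)" ?t "limit_activity k"
    by (rule window_profiles[OF window_converges ds])
  show ?thesis
  proof (rule density_tendsto)
    fix x :: real assume "0 < x"
    then have x: "0 \<le> x" by simp
    show "(\<lambda>j. I (d j) (?t j - x)) \<longlonglongrightarrow> Phi r (limit_activity k)"
    proof (rule Lim_transform_eventually)
      show "(\<lambda>j. I (d j) (real k * d j + max 0 (s j - x))) \<longlonglongrightarrow> Phi r (limit_activity k)"
        using activity_tendsto[OF late_in_window_shift(1)[OF ds x]] by (simp add: limit_activity_Suc)
      show "\<forall>\<^sub>F j in sequentially. I (d j) (real k * d j + max 0 (s j - x)) = I (d j) (?t j - x)"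
        using late_in_window_shift(2)[OF ds x] by eventually_elim (simp add: algebra_simps)
    qed
  qed
qed

end

section \<open>A Borel version of the discharge rate\<close>

text \<open>
A Lebesgue measurable rate agrees with a Borel function \<open>g\<close> almost everywhere in the plane, which
says nothing about a single activity level \<open>J\<close>. Continuity in \<open>J\<close> repairs this: for almost every
age the value at \<open>J\<close> is the limit of averages of \<open>g\<close> over short intervals near \<open>J\<close>, and these
averages are jointly Borel. On the exceptional null set of ages, and for nonpositive ages, the
rate is set to \<open>r0\<close>; outside \<open>[0, rM]\<close> the activity is clamped.
\<close>

lemma caratheodory_version:
  fixes f :: "real \<Rightarrow> real \<Rightarrow> real" and r0 rM :: real
  assumes r0: "0 < r0" and rM: "0 < rM"
    and meas: "(\<lambda>z. f (fst z) (snd z)) \<in> borel_measurable (lebesgue_on ({0<..} \<times> {0..rM}))"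
    and ge: "\<And>x J. 0 < x \<Longrightarrow> J \<in> {0..rM} \<Longrightarrow> r0 \<le> f x J"
    and le: "\<And>x J. 0 < x \<Longrightarrow> J \<in> {0..rM} \<Longrightarrow> f x J \<le> rM"
    and cont: "AE x in lebesgue_on {0<..}. continuous_on {0..rM} (f x)"
  obtains r where "age_rate r r0 rM"
    and "AE x in lebesgue. 0 < x \<longrightarrow> (\<forall>J\<in>{0..rM}. f x J = r x J)"
proof -
  define S where "S = {0::real<..} \<times> {0..rM}"
  have "S \<in> sets (borel \<Otimes>\<^sub>M borel)" unfolding S_def by (intro pair_measureI) auto
  then have "S \<in> sets lborel" unfolding borel_prod by simp
  then have S: "S \<in> sets lebesgue" by (rule sets_completionI_sets)
  define h where "h z = (if z \<in> S then f (fst z) (snd z) else 0)" for z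
  have "h \<in> borel_measurable lebesgue"
    using borel_measurable_if_I[OF meas S[unfolded S_def]] by (simp add: h_def[abs_def] S_def)
  then obtain g where "g \<in> borel_measurable lborel" and g: "AE z in lborel. h z = g z"
    using completion_ex_borel_measurable_real[of h lborel] by blast
  then have [measurable]: "g \<in> borel_measurable borel" by simp
  have "AE z in lborel \<Otimes>\<^sub>M lborel. h z = g z" unfolding lborel_prod by (rule g)
  then have hg: "AE x in lborel. AE y in lborel. h (x, y) = g (x, y)"
    by (rule lborel_pair.AE_pair)
  define good where "good x \<longleftrightarrow> (0 < x \<longrightarrow> continuous_on {0..rM} (f x)) \<and> (AE y in lborel. h (x, y) = g (x, y))" for x
  have "AE x in lborel. 0 < x \<longrightarrow> continuous_on {0..rM} (f x)"
    using cont by (simp add: AE_restrict_space_iff AE_completion_iff)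
  with hg have "AE x in lborel. good x" unfolding good_def by eventually_elim simp
  then obtain N where N: "{x \<in> space lborel. \<not> good x} \<subseteq> N" "emeasure lborel N = 0" "N \<in> sets lborel"
    by (rule AE_E)
  have good: "good x" if "x \<notin> N" for x using N(1) that by auto
  have [measurable]: "N \<in> sets borel" using N(3) by simp
  define w :: "nat \<Rightarrow> real" where "w m = inverse (real (Suc m))" for m
  have w: "0 < w m" "w m \<le> 1" for m by (auto simp: w_def field_simps)
  have w_lim: "w \<longlonglongrightarrow> 0" unfolding w_def by (rule LIMSEQ_inverse_real_of_nat)
  \<comment> \<open>The averaging interval is contracted towards \<open>J\<close> from \<open>[0, rM]\<close>, so it never leaves that range.\<close>
  define p where "p m J y = (1 - w m) * J + w m * rM * y" for m J y
  have p_range: "p m J y \<in> {0..rM}" if "J \<in> {0..rM}" "y \<in> {0..1}" for m J y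
  proof -
    have "(1 - w m) * J + w m * (rM * y) \<le> (1 - w m) * rM + w m * rM"
      using w[of m] that rM by (intro add_mono mult_left_mono mult_left_le) auto
    moreover have "0 \<le> (1 - w m) * J + w m * (rM * y)"
      using w[of m] that rM by (intro add_nonneg_nonneg mult_nonneg_nonneg) auto
    ultimately show ?thesis by (simp add: p_def algebra_simps)
  qed
  have p_lim: "(\<lambda>m. p m J y) \<longlonglongrightarrow> J" for J y
  proof -
    have "(\<lambda>m. p m J y) \<longlonglongrightarrow> (1 - 0) * J + 0 * rM * y"
      unfolding p_def by (intro tendsto_intros w_lim)
    then show ?thesis by simp
  qed
  define A where "A m x J = (LINT y|lborel. indicator {0..1} y * g (x, p m J y))" for m x J
  have A_lim: "(\<lambda>m. A m x J) \<longlonglongrightarrow> f x J" if x: "x \<notin> N" "0 < x" and J: "J \<in> {0..rM}" for x J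
  proof -
    have c: "continuous_on {0..rM} (f x)" and ae: "AE y in lebesgue. h (x, y) = g (x, y)"
      using good[OF x(1)] x(2) by (auto simp: good_def AE_completion_iff)
    have "AE y in lebesgue. h (x, p m J y) = g (x, p m J y)" for m
      unfolding p_def using AE_lebesgue_affine[OF ae, of "w m * rM"] w[of m] rM by simp
    then have "AE y in lborel. \<forall>m. h (x, p m J y) = g (x, p m J y)"
      by (simp add: AE_all_countable AE_completion_iff)
    then have eq: "AE y in lborel. \<forall>m. y \<in> {0..1} \<longrightarrow> g (x, p m J y) = f x (p m J y)"
      by eventually_elim (use p_range[OF J] x in \<open>auto simp: h_def S_def\<close>)
    have "(\<lambda>m. A m x J) \<longlonglongrightarrow> (LINT y|lborel. indicator {0..1::real} y * f x J)"
      unfolding A_def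
    proof (rule integral_dominated_convergence[where w = "\<lambda>y. rM * indicator {0..1} y"])
      show "AE y in lborel. (\<lambda>m. indicator {0..1} y * g (x, p m J y)) \<longlonglongrightarrow> indicator {0..1} y * f x J"
        using eq
      proof eventually_elim
        case (elim y)
        show ?case
        proof (cases "y \<in> {0..1::real}")
          case True
          have "(\<lambda>m. f x (p m J y)) \<longlonglongrightarrow> f x J"
            using continuous_on_tendsto_compose[OF c p_lim J] p_range[OF J True] by simp
          then show ?thesis using elim True by simp
        qed simp
      qed
      show "AE y in lborel. norm (indicator {0..1} y * g (x, p m J y)) \<le> rM * indicator {0..1} y" for m
        using eq
      proof eventually_elim
        case (elim y)
        show ?case
        proof (cases "y \<in> {0..1::real}")
          case True
          then show ?thesis
            using elim ge[OF x(2) p_range[OF J True, of m]] le[OF x(2) p_range[OF J True, of m]] r0 by simp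
        qed simp
      qed
      have "(\<lambda>y. (x, p m J y)) \<in> borel \<rightarrow>\<^sub>M borel" for m
        unfolding p_def by (intro borel_measurable_continuous_onI continuous_intros)
      from measurable_compose[OF this, of g borel]
      have "(\<lambda>y. g (x, p m J y)) \<in> borel_measurable borel" for m by simp
      then show "(\<lambda>y. indicator {0..1} y * g (x, p m J y)) \<in> borel_measurable lborel" for m
        by (intro borel_measurable_times) simp_all
    qed (auto intro!: integrable_mult_right integrable_real_indicator)
    then show ?thesis by simp
  qed
  define c where "c J = max 0 (min rM J)" for J
  have c: "c J \<in> {0..rM}" for J using rM by (auto simp: c_def)
  have c_id: "c J = J" if "J \<in> {0..rM}" for J using that by (auto simp: c_def)
  define r where "r x J = (if x \<in> N \<or> x \<le> 0 then r0 else lim (\<lambda>m. A m x (c J)))" for x J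
  have r_eq: "r x J = f x (c J)" if "x \<notin> N" "0 < x" for x J
    using A_lim[OF that c, THEN limI] that by (simp add: r_def)
  have r0_le_rM: "r0 \<le> rM" using ge[of 1 0] le[of 1 0] rM by simp
  show thesis
  proof
    show "AE x in lebesgue. 0 < x \<longrightarrow> (\<forall>J\<in>{0..rM}. f x J = r x J)"
    proof -
      have "AE x in lborel. x \<notin> N" using N by (intro AE_not_in) auto
      then have "AE x in lebesgue. x \<notin> N" by (simp add: AE_completion_iff)
      then show ?thesis by eventually_elim (simp add: r_eq c_id)
    qed
    show "age_rate r r0 rM"
    proof
      have "(\<lambda>z. A m (fst z) (c (snd z))) \<in> borel_measurable borel" for m
      proof -
        have "(\<lambda>v :: (real \<times> real) \<times> real. (fst (fst v), p m (c (snd (fst v))) (snd v))) \<in> borel \<rightarrow>\<^sub>M borel"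
          unfolding p_def c_def by (intro borel_measurable_continuous_onI continuous_intros)
        from measurable_compose[OF this, of g borel]
        have 1: "(\<lambda>v :: (real \<times> real) \<times> real. g (fst (fst v), p m (c (snd (fst v))) (snd v))) \<in> borel \<rightarrow>\<^sub>M borel"
          by simp
        have "(\<lambda>v :: (real \<times> real) \<times> real. snd v) \<in> borel \<rightarrow>\<^sub>M borel"
          by (intro borel_measurable_continuous_onI continuous_intros)
        from measurable_compose[OF this, of "indicator {0..1} :: real \<Rightarrow> real" borel]
        have 2: "(\<lambda>v :: (real \<times> real) \<times> real. indicator {0..1} (snd v) :: real) \<in> borel \<rightarrow>\<^sub>M borel"
          by simp
        have "sets ((borel :: (real \<times> real) measure) \<Otimes>\<^sub>M (lborel :: real measure)) = sets borel"
          by (simp add: borel_prod[symmetric] cong: sets_pair_measure_cong)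
        then have "(\<lambda>(z, y). indicator {0..1} y * g (fst z, p m (c (snd z)) y)) \<in> borel_measurable ((borel :: (real \<times> real) measure) \<Otimes>\<^sub>M lborel)"
          using borel_measurable_times[OF 2 1] by (simp add: split_beta' cong: measurable_cong_sets)
        then show ?thesis unfolding A_def by (rule lborel.borel_measurable_lebesgue_integral)
      qed
      then have "(\<lambda>z. lim (\<lambda>m. A m (fst z) (c (snd z)))) \<in> borel_measurable borel"
        by (intro borel_measurable_lim_metric)
      moreover have "{z :: real \<times> real. fst z \<in> N \<or> fst z \<le> 0} \<in> sets borel"
      proof -
        have "(fst :: real \<times> real \<Rightarrow> real) \<in> borel \<rightarrow>\<^sub>M borel"
          by (intro borel_measurable_continuous_onI continuous_intros)
        from measurable_sets[OF this, of "N \<union> {..0}"]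
        have "fst -` (N \<union> {..0}) \<in> sets (borel :: (real \<times> real) measure)" by simp
        moreover have "fst -` (N \<union> {..0}) = {z :: real \<times> real. fst z \<in> N \<or> fst z \<le> 0}" by auto
        ultimately show ?thesis by metis
      qed
      ultimately show "(\<lambda>z. r (fst z) (snd z)) \<in> borel_measurable borel"
        unfolding r_def by (intro measurable_If) simp_all
      fix x J
      show "r0 \<le> r x J" "r x J \<le> rM"
      proof -
        have "r0 \<le> r x J \<and> r x J \<le> rM"
        proof (cases "x \<in> N \<or> x \<le> 0")
          case True
          then have "r x J = r0" unfolding r_def by (rule if_P)
          then show ?thesis using r0_le_rM by simp
        next
          case False
          then have x: "x \<notin> N" "0 < x" by auto
          show ?thesis using ge[OF x(2) c] le[OF x(2) c] by (simp add: r_eq[OF x])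
        qed
        then show "r0 \<le> r x J" "r x J \<le> rM" by auto
      qed
      show "isCont (r x) J"
      proof (cases "x \<in> N \<or> x \<le> 0")
        case True
        then have "r x J = r0" for J unfolding r_def by (rule if_P)
        then have "r x = (\<lambda>_. r0)" by (rule ext)
        then show ?thesis by simp
      next
        case False
        then have "continuous_on {0..rM} (f x)" using good[of x] by (auto simp: good_def)
        moreover have "continuous_on UNIV c" unfolding c_def by (intro continuous_intros)
        ultimately have "continuous_on UNIV (\<lambda>J. f x (c J))"
          by (rule continuous_on_compose2) (use c in auto)
        moreover have "r x = (\<lambda>J. f x (c J))" by (rule ext, rule r_eq) (use False in auto)
        ultimately show ?thesis by (simp add: continuous_on_eq_continuous_at)
      qed
    qed (rule r0)
  qed
qed

section \<open>Transfer to the regularised rate\<close>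

text \<open>
Changing the rate on a null set of ages is invisible to the model: all integrals run along paths
on which the age moves with unit speed.
\<close>

locale rate_version = age_rate +
  fixes f :: "real \<Rightarrow> real \<Rightarrow> real"
  assumes version: "AE x in lebesgue. 0 < x \<longrightarrow> (\<forall>J\<in>{0..rM}. f x J = r x J)"
begin

lemma path_integral_version:
  assumes "\<And>u. u \<in> A \<Longrightarrow> h u \<in> {0..rM}" and "AE u in lebesgue. u \<in> A \<longrightarrow> 0 < c + u"
  shows "(LINT u:A|lebesgue. f (c + u) (h u)) = (LINT u:A|lebesgue. r (c + u) (h u))"
proof (rule set_lebesgue_integral_cong_AE_nonmeasurable)
  have "AE u in lebesgue. 0 < c + 1 * u \<longrightarrow> (\<forall>J\<in>{0..rM}. f (c + 1 * u) J = r (c + 1 * u) J)"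
    by (rule AE_lebesgue_affine[OF version]) simp
  with assms(2) show "AE u in lebesgue. u \<in> A \<longrightarrow> f (c + u) (h u) = r (c + u) (h u)"
    by eventually_elim (use assms(1) in auto)
qed

lemma R_int_version: "J \<in> {0..rM} \<Longrightarrow> R_int f x J = R_int r x J"
  unfolding R_int_def using path_integral_version[of "{0<..x}" "\<lambda>_. J" 0] by simp

lemma Phi_version: "J \<in> {0..rM} \<Longrightarrow> Phi f J = Phi r J"
  by (simp add: Phi_def R_int_version)

lemma nbar_version: "J \<in> {0..rM} \<Longrightarrow> nbar f x J = nbar r x J"
  by (simp add: nbar_def R_int_version Phi_version)

lemma iterate_version:
  assumes "J \<in> {0..rM}"
  shows "(Phi f ^^ k) J = (Phi r ^^ k) J \<and> (Phi r ^^ k) J \<in> {0..rM}"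
proof (induction k)
  case (Suc k)
  then show ?case
    using Phi_bounds[of "(Phi r ^^ k) J"] r0_pos by (simp add: Phi_version)
qed (use assms in simp)

text \<open>
The mass bound in the definition of \<^const>\<open>regular_solution\<close> holds because the ages \<open>x \<ge> t\<close>
carry the translated initial datum, damped along the characteristics by a factor of at most
\<open>exp (- r0 * t)\<close>.
\<close>

lemma regular_solution_if_delayed:
  assumes sol: "delayed_solution f rM n_ini I_ini d n I" and d: "0 < d"
    and ini_int: "set_integrable lebesgue {0<..} n_ini"
    and ini_nonneg: "AE x in lebesgue_on {0<..}. n_ini x \<ge> 0"
    and ini_mass: "(LINT x:{0<..}|lebesgue. n_ini x) = 1"
    and I_ini: "I_ini \<in> {0..rM}"
  shows "regular_solution I_ini d n (\<lambda>t. if t < 0 then I_ini else I t)"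
proof -
  define H where "H t = (if t < 0 then I_ini else I t)" for t
  note sol = sol[unfolded delayed_solution_def]
  have I_before: "\<forall>t\<in>{-d..<0}. I t = I_ini" using sol by (elim conjE)
  have I_range: "\<forall>t\<ge>-d. I t \<in> {0..rM}" using sol by (elim conjE)
  have I_flux: "\<forall>t\<ge>0. I t = (LINT x:{0<..}|lebesgue. f x (I (t - d)) * n t x)"
    using sol by (elim conjE)
  have n_mass: "\<forall>t\<ge>0. (LINT x:{0<..}|lebesgue. n t x) = 1" using sol by (elim conjE)
  have HI: "H t = I t" if "- d \<le> t" for t using I_before that by (auto simp: H_def)
  have H_range: "H t \<in> {0..rM}" for t using I_range I_ini d by (auto simp: H_def)
  have H_meas: "H \<in> borel_measurable lebesgue"
  proof -
    have "I \<in> borel_measurable (lebesgue_on {-d..})" using sol by blast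
    then have [measurable]: "(\<lambda>t. if t \<in> {-d..} then I t else 0) \<in> borel_measurable lebesgue"
      by (rule borel_measurable_if_I) simp
    have "(\<lambda>t. if t < 0 then I_ini else if t \<in> {-d..} then I t else 0) \<in> borel_measurable lebesgue"
      by measurable
    moreover have "H = (\<lambda>t. if t < 0 then I_ini else if t \<in> {-d..} then I t else 0)"
      using d by (auto simp: H_def)
    ultimately show ?thesis by simp
  qed
  have n_int: "set_integrable lebesgue {0<..} (n t)" if "0 \<le> t" for t using sol that by blast
  have n_nonneg: "AE x in lebesgue. 0 < x \<longrightarrow> 0 \<le> n t x" if "0 \<le> t" for t
  proof -
    have "AE x in lebesgue_on {0<..}. n t x \<ge> 0" using sol that by blast
    then show ?thesis by (simp add: AE_restrict_space_iff)
  qed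
  have n_char: "AE x in lebesgue. 0 < x \<longrightarrow> n t x =
        (if x \<ge> t
         then n_ini (x - t) * exp (- (LINT s:{0..t}|lebesgue. f (x - t + s) (I (s - d))))
         else I (t - x) * exp (- (LINT s:{0..x}|lebesgue. f s (I (t - x + s - d)))))" if "0 \<le> t" for t
  proof -
    have "AE x in lebesgue_on {0<..}. n t x =
        (if x \<ge> t
         then n_ini (x - t) * exp (- (LINT s:{0..t}|lebesgue. f (x - t + s) (I (s - d))))
         else I (t - x) * exp (- (LINT s:{0..x}|lebesgue. f s (I (t - x + s - d)))))"
      using sol that by blast
    then show ?thesis by (simp add: AE_restrict_space_iff)
  qed
  have n_eq: "AE x in lebesgue. 0 < x \<longrightarrow> x < t \<longrightarrow> n t x = H (t - x) * surv (\<lambda>y. H (t - d - y)) x"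
    if t: "0 \<le> t" for t
    using n_char[OF t]
  proof (eventually_elim, intro impI)
    fix x assume x: "0 < x" "x < t" and "0 < x \<longrightarrow> n t x =
        (if x \<ge> t
         then n_ini (x - t) * exp (- (LINT s:{0..t}|lebesgue. f (x - t + s) (I (s - d))))
         else I (t - x) * exp (- (LINT s:{0..x}|lebesgue. f s (I (t - x + s - d)))))"
    then have "n t x = I (t - x) * exp (- (LINT s:{0..x}|lebesgue. f s (I (t - x + s - d))))" by simp
    moreover have "(LINT s:{0..x}|lebesgue. f s (I (t - x + s - d)))
        = (LINT s:{0..x}|lebesgue. f s (H (t - d - (x - s))))"
      by (rule set_lebesgue_integral_cong) (use x in \<open>auto simp: HI algebra_simps\<close>)
    moreover have "AE u in lebesgue. u \<in> {0..x} \<longrightarrow> 0 < 0 + u"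
      using AE_neq_lebesgue[of 0] by eventually_elim auto
    then have "(LINT s:{0..x}|lebesgue. f s (H (t - d - (x - s))))
        = (LINT s:{0..x}|lebesgue. r s (H (t - d - (x - s))))"
      using path_integral_version[of "{0..x}" "\<lambda>s. H (t - d - (x - s))" 0, OF H_range] by simp
    ultimately show "n t x = H (t - x) * surv (\<lambda>y. H (t - d - y)) x"
      using x d by (simp add: surv_def hazard_def HI)
  qed
  have tail: "(LINT x:{0<..}|lebesgue. indicator {t..} x * n t x) \<le> exp (- r0 * t)" if t: "0 \<le> t" for t
  proof -
    define q where "q y = indicator {0<..} y *\<^sub>R n_ini y" for y
    have q: "has_bochner_integral lebesgue q 1"
      using ini_int ini_mass
      by (simp add: has_bochner_integral_iff q_def[abs_def] set_integrable_def set_lebesgue_integral_def)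
    have q_shift: "has_bochner_integral lebesgue (\<lambda>x. q (x - t)) 1"
      using has_bochner_integral_lebesgue_real_affine_iff[of 1 q 1 "- t"] q by simp
    have "AE y in lebesgue. 0 < y \<longrightarrow> 0 \<le> n_ini y"
      using ini_nonneg by (simp add: AE_restrict_space_iff)
    from AE_lebesgue_affine[OF this, of 1 "- t"]
    have ini_pos: "AE x in lebesgue. 0 < x - t \<longrightarrow> 0 \<le> n_ini (x - t)" by simp
    have "(LINT x:{0<..}|lebesgue. indicator {t..} x * n t x) \<le> (LINT x|lebesgue. exp (- r0 * t) * q (x - t))"
      unfolding set_lebesgue_integral_def
    proof (rule integral_mono_AE)
      have "integrable lebesgue (\<lambda>x. indicator {t..} x *\<^sub>R (indicator {0<..} x *\<^sub>R n t x))"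
        by (rule integrable_mult_indicator) (use n_int[OF t] in \<open>simp_all add: set_integrable_def\<close>)
      then show "integrable lebesgue (\<lambda>x. indicator {0<..} x *\<^sub>R (indicator {t..} x * n t x))"
        by (simp add: mult.left_commute)
      show "integrable lebesgue (\<lambda>x. exp (- r0 * t) * q (x - t))"
        using q_shift by (auto simp: has_bochner_integral_iff)
      show "AE x in lebesgue. indicator {0<..} x *\<^sub>R (indicator {t..} x * n t x) \<le> exp (- r0 * t) * q (x - t)"
        using n_char[OF t] ini_pos AE_neq_lebesgue[of t]
      proof eventually_elim
        case (elim x)
        show ?case
        proof (cases "0 < x \<and> t \<le> x")
          case True
          then have xt: "t < x" "0 < x" using elim by auto
          interpret shifted: age_rate "\<lambda>s J. r (x - t + s) J" r0 rM
          proof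
            show "(\<lambda>z. r (x - t + fst z) (snd z)) \<in> borel_measurable borel"
              by (intro r_measurable borel_measurable_continuous_onI continuous_intros)
          qed (use r0_pos r_ge r_le r_cont in auto)
          have "(\<lambda>s. H (s - d)) \<in> borel_measurable lebesgue"
            using borel_measurable_lebesgue_affine[OF H_meas, of 1 "- d"] by simp
          then have "r0 * t \<le> (LINT s:{0..t}|lebesgue. r (x - t + s) (H (s - d)))"
            using shifted.rate_integral_bounds(1)[of "\<lambda>s. H (s - d)" 0 t] t by simp
          also have "\<dots> = (LINT s:{0..t}|lebesgue. f (x - t + s) (H (s - d)))"
            by (rule path_integral_version[symmetric]) (use H_range xt in auto)
          also have "\<dots> = (LINT s:{0..t}|lebesgue. f (x - t + s) (I (s - d)))"
            by (rule set_lebesgue_integral_cong) (auto simp: HI)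
          finally have e: "exp (- (LINT s:{0..t}|lebesgue. f (x - t + s) (I (s - d)))) \<le> exp (- r0 * t)"
            by simp
          have "n t x = n_ini (x - t) * exp (- (LINT s:{0..t}|lebesgue. f (x - t + s) (I (s - d))))"
            using elim(1) xt by simp
          also have "\<dots> \<le> n_ini (x - t) * exp (- r0 * t)"
            using elim(2) xt e by (intro mult_left_mono) auto
          finally show ?thesis using xt by (simp add: q_def mult.commute)
        next
          case False
          have "0 \<le> q (x - t)" using elim(2) by (simp add: q_def indicator_def)
          then show ?thesis using False by (auto simp: indicator_def)
        qed
      qed
    qed
    also have "\<dots> = exp (- r0 * t)" using q_shift by (simp add: has_bochner_integral_iff)
    finally show ?thesis .
  qed
  have flux: "H t = (LINT x:{0<..}|lebesgue. r x (H (t - d)) * n t x)" if t: "0 \<le> t" for t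
  proof -
    have "H t = (LINT x:{0<..}|lebesgue. f x (I (t - d)) * n t x)"
      using I_flux t by (simp add: H_def)
    also have "\<dots> = (LINT x:{0<..}|lebesgue. r x (H (t - d)) * n t x)"
    proof (rule set_lebesgue_integral_cong_AE_nonmeasurable)
      show "AE x in lebesgue. x \<in> {0<..} \<longrightarrow> f x (I (t - d)) * n t x = r x (H (t - d)) * n t x"
        using version by eventually_elim (use H_range[of "t - d"] HI[of "t - d"] t in auto)
    qed
    finally show ?thesis .
  qed
  have "regular_solution I_ini d n H"
    unfolding regular_solution_def
  proof (intro conjI allI impI)
    show "H t = I_ini" if "t < 0" for t using that by (simp add: H_def)
    show "(LINT x:{0<..}|lebesgue. n t x) = 1" if "0 \<le> t" for t using n_mass that by simp
  qed (fact H_meas H_range n_int n_nonneg n_eq tail flux)+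
  then show ?thesis by (simp add: H_def[abs_def])
qed

end

section \<open>Rescaled time\<close>

lemma infsum_window:
  fixes g :: "nat \<Rightarrow> real"
  assumes "0 \<le> \<tau>" "Suc (nat \<lfloor>\<tau>\<rfloor>) \<in> A"
  shows "(\<Sum>\<^sub>\<infinity>i\<in>A. g i * indicator {real i - 1..<real i} \<tau>) = g (Suc (nat \<lfloor>\<tau>\<rfloor>))"
proof -
  have ind: "indicator {real i - 1..<real i} \<tau> = (if i = Suc (nat \<lfloor>\<tau>\<rfloor>) then 1 else 0 :: real)" for i
    using assms(1) by (auto simp: indicator_def) linarith+
  have "(\<Sum>\<^sub>\<infinity>i\<in>A. g i * indicator {real i - 1..<real i} \<tau>)
      = (\<Sum>\<^sub>\<infinity>i\<in>{Suc (nat \<lfloor>\<tau>\<rfloor>)}. g i * indicator {real i - 1..<real i} \<tau>)"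
    by (rule infsum_cong_neutral) (use assms(2) in \<open>auto simp: ind\<close>)
  then show ?thesis by (simp add: ind)
qed

lemma n_infty_window:
  "0 \<le> \<tau> \<Longrightarrow> n_infty f \<tau> x J = nbar f x ((Phi f ^^ nat \<lfloor>\<tau>\<rfloor>) J)"
  unfolding n_infty_def
  by (subst infsum_window[where g = "\<lambda>k. nbar f x ((Phi f ^^ (k - 1)) J)"]) auto

lemma I_infty_window:
  "0 \<le> \<tau> \<Longrightarrow> I_infty f \<tau> J = (Phi f ^^ Suc (nat \<lfloor>\<tau>\<rfloor>)) J"
  unfolding I_infty_def by (rule infsum_window[where g = "\<lambda>k. (Phi f ^^ k) J"]) auto

lemma L1_norm_diff_densities:
  assumes "set_integrable lebesgue {0<..} u" "set_integrable lebesgue {0<..} v"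
    and "AE x in lebesgue. 0 < x \<longrightarrow> 0 \<le> u x" "\<And>x. 0 \<le> v x"
    and "(LINT x:{0<..}|lebesgue. u x) = 1" "(LINT x:{0<..}|lebesgue. v x) = 1"
  shows "\<bar>L1_norm (\<lambda>x. u x - v x)\<bar> \<le> 2"
proof -
  have "(LINT x:{0<..}|lebesgue. \<bar>u x - v x\<bar>) \<le> (LINT x:{0<..}|lebesgue. u x + v x)"
  proof (rule set_integral_mono_AE)
    show "AE x \<in> {0<..} in lebesgue. \<bar>u x - v x\<bar> \<le> u x + v x"
      using assms(3)
    proof eventually_elim
      case (elim x)
      then show ?case using assms(4)[of x] by auto
    qed
  qed (use assms(1,2) in \<open>auto intro: set_integrable_abs\<close>)
  then have "L1_norm (\<lambda>x. u x - v x) \<le> 2"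
    using assms by (simp add: L1_norm_def set_integral_add)
  then show ?thesis using L1_norm_nonneg[of "\<lambda>x. u x - v x"] by simp
qed

lemma tendsto_at_top_real_via_positive_sequences:
  fixes F :: "real \<Rightarrow> real"
  assumes "\<And>d. filterlim d at_top sequentially \<Longrightarrow> (\<And>j. 0 < d j) \<Longrightarrow> (\<lambda>j. F (d j)) \<longlonglongrightarrow> c"
  shows "(F \<longlongrightarrow> c) at_top"
proof (rule tendsto_at_topI_sequentially)
  fix X :: "nat \<Rightarrow> real" assume X: "filterlim X at_top sequentially"
  then have "\<forall>\<^sub>F j in sequentially. 1 \<le> X j" by (simp add: filterlim_at_top)
  then have ev: "\<forall>\<^sub>F j in sequentially. F (max 1 (X j)) = F (X j)"
    by eventually_elim simp
  have "filterlim (\<lambda>j. max 1 (X j)) at_top sequentially"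
    using X by (rule filterlim_at_top_mono) simp
  then have "(\<lambda>j. F (max 1 (X j))) \<longlonglongrightarrow> c" by (rule assms) simp
  then show "(\<lambda>j. F (X j)) \<longlonglongrightarrow> c" using ev by (rule Lim_transform_eventually)
qed

context delayed_family begin

text \<open>
A rescaled time strictly inside a unit interval becomes a time at distance proportional to \<open>d\<close>
from the ends of its window. At integer times the convergence may fail; they form a null set.
\<close>

lemma rescaled_tendsto:
  assumes d: "filterlim d at_top sequentially" "\<And>j. 0 < d j"
    and \<tau>: "0 \<le> \<tau>" "\<tau> \<notin> \<nat>"
  shows "(\<lambda>j. I (d j) (\<tau> * d j)) \<longlonglongrightarrow> limit_activity (Suc (nat \<lfloor>\<tau>\<rfloor>))"
    and "(\<lambda>j. L1_norm (\<lambda>x. n (d j) (\<tau> * d j) x - nbar r x (limit_activity (nat \<lfloor>\<tau>\<rfloor>)))) \<longlonglongrightarrow> 0"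
proof -
  let ?k = "nat \<lfloor>\<tau>\<rfloor>" and ?s = "\<lambda>j. (\<tau> - real (nat \<lfloor>\<tau>\<rfloor>)) * d j"
  have "real ?k \<noteq> \<tau>" using \<tau>(2) by (metis of_nat_in_Nats)
  moreover have le: "real ?k \<le> \<tau>" "\<tau> < real ?k + 1" using \<tau>(1) by linarith+
  ultimately have "real ?k < \<tau>" by (metis order_le_less)
  then have frac: "0 < \<tau> - real ?k" "\<tau> - real ?k < 1" using le(2) by linarith+
  have "filterlim ?s at_top sequentially"
    by (rule filterlim_tendsto_pos_mult_at_top[OF tendsto_const frac(1) d(1)])
  then have adm: "late_in_window d ?s"
    using frac d(2) by (auto simp: late_in_window_def less_imp_le)
  have eq: "real ?k * d j + ?s j = \<tau> * d j" for j by (simp add: algebra_simps)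
  show "(\<lambda>j. I (d j) (\<tau> * d j)) \<longlonglongrightarrow> limit_activity (Suc ?k)"
    using activity_tendsto[OF adm, of ?k] by (simp only: eq)
  show "(\<lambda>j. L1_norm (\<lambda>x. n (d j) (\<tau> * d j) x - nbar r x (limit_activity ?k))) \<longlonglongrightarrow> 0"
    using solution_tendsto[OF adm, of ?k] by (simp only: eq)
qed

end

theorem theorem3p4:
  fixes r :: "real \<Rightarrow> real \<Rightarrow> real" and rM r0 I_ini :: real and n_ini :: "real \<Rightarrow> real"
    and n :: "real \<Rightarrow> real \<Rightarrow> real \<Rightarrow> real" and I :: "real \<Rightarrow> real \<Rightarrow> real"
  assumes "rM > 0"
    and "(\<lambda>z. r (fst z) (snd z)) \<in> borel_measurable (lebesgue_on ({0<..} \<times> {0..rM}))"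
    and "\<And>x J. x > 0 \<Longrightarrow> J \<in> {0..rM} \<Longrightarrow> 0 \<le> r x J \<and> r x J \<le> rM"
    and "AE x in lebesgue_on {0<..}. continuous_on {0..rM} (r x)"
    and "\<exists>g. Linfty ({0<..} \<times> {0<..<rM}) g \<and> weak_partial_snd ({0<..} \<times> {0<..<rM}) r g"
    and "r0 > 0"
    and "\<And>x J. x > 0 \<Longrightarrow> J \<in> {0..rM} \<Longrightarrow> r x J \<ge> r0"
    and "set_integrable lebesgue {0<..} n_ini"
    and "AE x in lebesgue_on {0<..}. n_ini x \<ge> 0"
    and "(LINT x:{0<..}|lebesgue. n_ini x) = 1"
    and "I_ini \<in> {0..rM}"
    and "\<And>d. d > 0 \<Longrightarrow> delayed_solution r rM n_ini I_ini d (n d) (I d)"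
  shows "\<forall>N::nat.
    ((\<lambda>d. LINT \<tau>:{0..real N}|lebesgue. L1_norm (\<lambda>x. n d (\<tau> * d) x - n_infty r \<tau> x I_ini))
       \<longlongrightarrow> 0) at_top \<and>
    ((\<lambda>d. LINT \<tau>:{0..real N}|lebesgue. \<bar>I d (\<tau> * d) - I_infty r \<tau> I_ini\<bar>)
       \<longlongrightarrow> 0) at_top"
proof -
  \<comment> \<open>From here on the rate is replaced by its Borel version, and the activities are extended to all times.\<close>
  obtain r' where r': "age_rate r' r0 rM"
    and version: "AE x in lebesgue. 0 < x \<longrightarrow> (\<forall>J\<in>{0..rM}. r x J = r' x J)"
    by (rule caratheodory_version[OF assms(6,1,2,7) _ assms(4)]) (use assms(3) in auto)
  define H where "H d t = (if t < 0 then I_ini else I d t)" for d t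
  interpret rate_version r' r0 rM r
    using r' version by (simp add: rate_version_def rate_version_axioms_def)
  interpret delayed_family r' r0 rM I_ini n H
  proof
    fix d :: real assume "0 < d"
    show "regular_solution I_ini d (n d) (H d)"
      using regular_solution_if_delayed[OF assms(12)[OF \<open>0 < d\<close>] \<open>0 < d\<close> assms(8-11)]
      by (simp add: H_def[abs_def])
  qed
  have limit_eq: "(Phi r ^^ k) I_ini = limit_activity k" and limit_range: "limit_activity k \<in> {0..rM}" for k
    using iterate_version[OF assms(11), of k] by (simp_all add: limit_activity_def)
  have n_infty: "n_infty r \<tau> x I_ini = nbar r' x (limit_activity (nat \<lfloor>\<tau>\<rfloor>))" if "0 \<le> \<tau>" for \<tau> x
    using that limit_range by (simp add: n_infty_window limit_eq nbar_version)
  have I_infty: "I_infty r \<tau> I_ini = limit_activity (Suc (nat \<lfloor>\<tau>\<rfloor>))" if "0 \<le> \<tau>" for \<tau>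
    using that by (simp only: I_infty_window limit_eq)
  have AE_not_nat: "AE \<tau> in lebesgue. (\<tau> :: real) \<notin> \<nat>"
    unfolding AE_completion_iff by (intro AE_not_in countable_imp_null_set_lborel) (simp add: Nats_def)
  have "((\<lambda>d. LINT \<tau>:{0..real N}|lebesgue. L1_norm (\<lambda>x. n d (\<tau> * d) x - n_infty r \<tau> x I_ini))
       \<longlongrightarrow> 0) at_top" for N :: nat
  proof (rule tendsto_at_top_real_via_positive_sequences)
    fix d :: "nat \<Rightarrow> real" assume d: "filterlim d at_top sequentially" "\<And>j. 0 < d j"
    have nonneg: "0 \<le> \<tau> * d j" if "0 \<le> \<tau>" for \<tau> j using that d(2)[of j] by simp
    note R = sol[OF d(2), unfolded regular_solution_def]
    show "(\<lambda>j. LINT \<tau>:{0..real N}|lebesgue. L1_norm (\<lambda>x. n (d j) (\<tau> * d j) x - n_infty r \<tau> x I_ini))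
        \<longlonglongrightarrow> 0"
    proof (rule bounded_integral_tendsto_zero)
      fix j \<tau> assume "\<tau> \<in> {0..real N}"
      then have \<tau>: "0 \<le> \<tau>" by simp
      have "set_integrable lebesgue {0<..} (n (d j) (\<tau> * d j))"
        "AE x in lebesgue. 0 < x \<longrightarrow> 0 \<le> n (d j) (\<tau> * d j) x"
        "(LINT x:{0<..}|lebesgue. n (d j) (\<tau> * d j) x) = 1"
        using R[of j] nonneg[OF \<tau>, of j] by (elim conjE, simp)+
      from L1_norm_diff_densities[OF this(1) nbar_integrable this(2) nbar_nonneg this(3) nbar_mass]
      show "\<bar>L1_norm (\<lambda>x. n (d j) (\<tau> * d j) x - n_infty r \<tau> x I_ini)\<bar> \<le> 2"
        by (simp add: n_infty[OF \<tau>])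
    next
      show "AE \<tau> in lebesgue. \<tau> \<in> {0..real N} \<longrightarrow>
          (\<lambda>j. L1_norm (\<lambda>x. n (d j) (\<tau> * d j) x - n_infty r \<tau> x I_ini)) \<longlonglongrightarrow> 0"
        using AE_not_nat
        by eventually_elim (use rescaled_tendsto(2)[OF d] in \<open>simp add: n_infty\<close>)
    qed (simp_all add: emeasure_lborel_Icc_eq)
  qed
  moreover have "((\<lambda>d. LINT \<tau>:{0..real N}|lebesgue. \<bar>I d (\<tau> * d) - I_infty r \<tau> I_ini\<bar>)
       \<longlongrightarrow> 0) at_top" for N :: nat
  proof (rule tendsto_at_top_real_via_positive_sequences)
    fix d :: "nat \<Rightarrow> real" assume d: "filterlim d at_top sequentially" "\<And>j. 0 < d j"
    have nonneg: "0 \<le> \<tau> * d j" if "0 \<le> \<tau>" for \<tau> j using that d(2)[of j] by simp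
    note R = sol[OF d(2), unfolded regular_solution_def]
    show "(\<lambda>j. LINT \<tau>:{0..real N}|lebesgue. \<bar>I (d j) (\<tau> * d j) - I_infty r \<tau> I_ini\<bar>) \<longlonglongrightarrow> 0"
    proof (rule bounded_integral_tendsto_zero)
      fix j \<tau> assume "\<tau> \<in> {0..real N}"
      then have \<tau>: "0 \<le> \<tau>" by simp
      have "H (d j) (\<tau> * d j) \<in> {0..rM}" using R[of j] by (elim conjE) simp
      then have "I (d j) (\<tau> * d j) \<in> {0..rM}" using nonneg[OF \<tau>, of j] by (simp add: H_def)
      then show "\<bar>\<bar>I (d j) (\<tau> * d j) - I_infty r \<tau> I_ini\<bar>\<bar> \<le> rM"
        using limit_range[of "Suc (nat \<lfloor>\<tau>\<rfloor>)"] by (auto simp: I_infty[OF \<tau>])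
    next
      show "AE \<tau> in lebesgue. \<tau> \<in> {0..real N} \<longrightarrow>
          (\<lambda>j. \<bar>I (d j) (\<tau> * d j) - I_infty r \<tau> I_ini\<bar>) \<longlonglongrightarrow> 0"
        using AE_not_nat
      proof (eventually_elim, intro impI)
        fix \<tau> :: real assume "\<tau> \<notin> \<nat>" "\<tau> \<in> {0..real N}"
        then have \<tau>: "0 \<le> \<tau>" "\<tau> \<notin> \<nat>" by auto
        have "(\<lambda>j. \<bar>H (d j) (\<tau> * d j) - limit_activity (Suc (nat \<lfloor>\<tau>\<rfloor>))\<bar>) \<longlonglongrightarrow> 0"
          using rescaled_tendsto(1)[OF d \<tau>] by (intro tendsto_rabs_zero LIM_zero)
        moreover have "H (d j) (\<tau> * d j) = I (d j) (\<tau> * d j)" for j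
          using nonneg[OF \<tau>(1), of j] by (simp add: H_def)
        ultimately show "(\<lambda>j. \<bar>I (d j) (\<tau> * d j) - I_infty r \<tau> I_ini\<bar>) \<longlonglongrightarrow> 0"
          by (simp add: I_infty[OF \<tau>(1)])
      qed
    qed (simp_all add: emeasure_lborel_Icc_eq)
  qed
  ultimately show ?thesis by blast
qed

end
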